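(* Let $p(z_1,\ldots,z_d)$ be a complex polynomial of multidegree $(n_1,\ldots,n_d)$ such that for some $\epsilon>0$ we have $$|p(z_1,\ldots,z_d)| \ge \epsilon \prod_{j=1}^d |z_j+i|^{n_j}, \qquad z_1,\ldots,z_d \in \mathbb{H}.$$ Then there exist a polynomial $q(z_1,\ldots,z_d)$ and square complex matrices $A_0,A_1,\ldots,A_d$ of the same size such that $$\operatorname{Im} A_0 = \frac{1}{2i}(A_0-A_0^* ) > 0,\qquad A_j \ge 0,\ j=1,\ldots,d,\qquad A_1+\cdots+A_d>0,$$ and $$p(z_1,\ldots,z_d)\,q(z_1,\ldots,z_d) = \det(A_0+z_1A_1+\cdots+z_dA_d).$$
   Context: $\mathbb{H}=\{z\in\mathbb{C} : \operatorname{Im} z>0\}$. Multidegree $(n_1,\ldots,n_d)$ means that $p$ has degree $n_j$ in the variable $z_j$. For Hermitian matrices, $X>0$ (resp. $X\ge 0$) means positive definite (resp. positive semidefinite). *)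

theory Defs
  imports "Jordan_Normal_Form.Schur_Decomposition" "HOL-Library.Poly_Mapping"
begin

text \<open>A complex polynomial in variables indexed by \<^typ>\<open>nat\<close> is a finitely supported map from
  monomials (finitely supported exponent functions) to coefficients.  The variable $z_j$ has
  index \<open>j\<close>, so the polynomials in $z_1, \dots, z_d$ are those with
  \<open>poly_vars p \<subseteq> {1..d}\<close>.\<close>

type_synonym cpoly = "(nat \<Rightarrow>\<^sub>0 nat) \<Rightarrow>\<^sub>0 complex"

definition poly_vars :: "cpoly \<Rightarrow> nat set" where
  "poly_vars p = (\<Union>m\<in>Poly_Mapping.keys p. Poly_Mapping.keys m)"

definition poly_eval :: "cpoly \<Rightarrow> (nat \<Rightarrow> complex) \<Rightarrow> complex" where
  "poly_eval p z = (\<Sum>m\<in>Poly_Mapping.keys p.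
     Poly_Mapping.lookup p m * (\<Prod>j\<in>Poly_Mapping.keys m. z j ^ Poly_Mapping.lookup m j))"

text \<open>Inserting \<open>0\<close> only matters for \<open>p = 0\<close>, whose degree in each variable is set to \<open>0\<close>.\<close>

definition degree_in :: "cpoly \<Rightarrow> nat \<Rightarrow> nat" where
  "degree_in p j = Max (insert 0 ((\<lambda>m. Poly_Mapping.lookup m j) ` Poly_Mapping.keys p))"

definition hermitian_mat :: "complex mat \<Rightarrow> bool" where
  "hermitian_mat A \<longleftrightarrow> square_mat A \<and> mat_adjoint A = A"

text \<open>\<open>(A *\<^sub>v v) \<bullet>c v\<close> is $v^* A v$, which is real for Hermitian \<open>A\<close>.\<close>

definition pos_semidef_mat :: "complex mat \<Rightarrow> bool" where
  "pos_semidef_mat A \<longleftrightarrow> hermitian_mat A \<and>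
     (\<forall>v\<in>carrier_vec (dim_row A). 0 \<le> Re ((A *\<^sub>v v) \<bullet>c v))"

definition pos_def_mat :: "complex mat \<Rightarrow> bool" where
  "pos_def_mat A \<longleftrightarrow> hermitian_mat A \<and>
     (\<forall>v\<in>carrier_vec (dim_row A). v \<noteq> 0\<^sub>v (dim_row A) \<longrightarrow> 0 < Re ((A *\<^sub>v v) \<bullet>c v))"

definition Im_mat :: "complex mat \<Rightarrow> complex mat" where
  "Im_mat A = (1 / (2 * \<i>)) \<cdot>\<^sub>m (A - mat_adjoint A)"

text \<open>\<^typ>\<open>complex mat\<close> has no zero common to all sizes, hence no generic \<^const>\<open>sum\<close>; the sum of
  \<open>N \<times> N\<close> matrices is taken entrywise.\<close>

definition mat_sum :: "nat \<Rightarrow> ('i \<Rightarrow> complex mat) \<Rightarrow> 'i set \<Rightarrow> complex mat" where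
  "mat_sum N B J = mat N N (\<lambda>(r, c). \<Sum>j\<in>J. B j $$ (r, c))"

end

theory Submission
  imports "HOL-Complex_Analysis.Complex_Analysis" Defs
begin

text \<open>The Cayley transform $w = (z-i)/(z+i)$ maps the half-plane onto the unit disc and turns \<open>p\<close> into
  the polynomial $P(w) = \prod_j (1-w_j)^{n_j}\, p(i(1+w)/(1-w))$.  Since $z+i = 2i/(1-w)$, the lower
  bound on \<open>p\<close> says exactly that $|P|$ is bounded away from $0$ on the unit polydisc, and then
  \<open>P\<close> is still bounded away from $0$ on a slightly larger one
  (\<open>lower_bound_on_larger_polydisc\<close>).

  It suffices to find a polynomial \<open>G\<close> and a strict contraction \<open>S\<close> with $P\,G = \det(1 - W S)$, where
  \<open>W\<close> is diagonal and each diagonal entry is one of the variables $w_j$.  Undoing the Cayley transform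
  multiplies the rows by factors $z_j+i$ and turns $1 - WS$ into
  $(Z+i) - (Z-i)S = (Z + A_0)(1-S)$ with $A_0 = i(1+S)(1-S)^{-1}$.  The imaginary part of $A_0$ is
  positive definite precisely because \<open>S\<close> is a strict contraction
  (\<open>cayley_transform_of_strict_contraction\<close>), and \<open>Z\<close> is a sum of coordinate projections times
  variables.

  The multiplier \<open>G\<close> may be chosen freely, and this makes the problem on the polydisc easy.  The
  expansion of $1/P$ into homogeneous polynomials converges geometrically, so its partial sums \<open>G\<close> give
  $P\,G = 1 - h$, where \<open>h\<close> has no constant term and the absolute values of its coefficients have sum at
  most $1$ (\<open>multiple_close_to_1\<close>).  Such a $1-h$ is the determinant of an explicit network
  (\<open>word_sum_determinant\<close>): every monomial of \<open>h\<close> is a closed walk which starts and ends in a common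
  hub and picks up one variable per step.  Any two of these cycles meet in the hub, so the cycle
  expansion of the determinant is $1$ minus the sum of the cycle weights; eliminating the hub itself leaves
  a rank-one term in the matrix.  If the coefficient of a monomial
  is divided evenly between the entry and the exit of its walk, the Cauchy--Schwarz inequality shows that
  the network matrix is a contraction (\<open>network_contraction\<close>).  Strictness comes from the larger
  polydisc, by a dilation.\<close>

section \<open>Evaluation of polynomials\<close>

definition monom_eval :: "(nat \<Rightarrow> complex) \<Rightarrow> (nat \<Rightarrow>\<^sub>0 nat) \<Rightarrow> complex" where
  "monom_eval z m = (\<Prod>j\<in>Poly_Mapping.keys m. z j ^ Poly_Mapping.lookup m j)"

definition total_deg :: "(nat \<Rightarrow>\<^sub>0 nat) \<Rightarrow> nat" where
  "total_deg m = (\<Sum>j\<in>Poly_Mapping.keys m. Poly_Mapping.lookup m j)"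

lemma monom_eval_superset:
  assumes "finite S" "Poly_Mapping.keys m \<subseteq> S"
  shows "monom_eval z m = (\<Prod>j\<in>S. z j ^ Poly_Mapping.lookup m j)"
  unfolding monom_eval_def
  by (rule prod.mono_neutral_left) (use assms in \<open>auto simp: in_keys_iff\<close>)

lemma total_deg_superset:
  assumes "finite S" "Poly_Mapping.keys m \<subseteq> S"
  shows "total_deg m = (\<Sum>j\<in>S. Poly_Mapping.lookup m j)"
  unfolding total_deg_def
  by (rule sum.mono_neutral_left) (use assms in \<open>auto simp: in_keys_iff\<close>)

lemma lookup_le_total_deg: "Poly_Mapping.lookup m j \<le> total_deg m"
proof (cases "j \<in> Poly_Mapping.keys m")
  case True
  then show ?thesis unfolding total_deg_def by (intro member_le_sum) auto
qed (simp add: in_keys_iff)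

lemma monom_eval_add: "monom_eval z (m + m') = monom_eval z m * monom_eval z m'"
proof -
  let ?S = "Poly_Mapping.keys m \<union> Poly_Mapping.keys m'"
  have "Poly_Mapping.keys (m + m') \<subseteq> ?S" by (rule keys_add)
  then show ?thesis
    by (simp add: monom_eval_superset[of ?S] lookup_add power_add prod.distrib)
qed

lemma total_deg_add: "total_deg (m + m') = total_deg m + total_deg m'"
proof -
  let ?S = "Poly_Mapping.keys m \<union> Poly_Mapping.keys m'"
  have "Poly_Mapping.keys (m + m') \<subseteq> ?S" by (rule keys_add)
  then show ?thesis
    by (simp add: total_deg_superset[of ?S] lookup_add sum.distrib)
qed

lemma poly_eval_superset:
  assumes "finite S" "Poly_Mapping.keys p \<subseteq> S"
  shows "poly_eval p z = (\<Sum>m\<in>S. Poly_Mapping.lookup p m * monom_eval z m)"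
  unfolding poly_eval_def monom_eval_def
  by (rule sum.mono_neutral_left) (use assms in \<open>auto simp: in_keys_iff\<close>)

lemma poly_eval_monoms:
  "poly_eval p z = (\<Sum>m\<in>Poly_Mapping.keys p. Poly_Mapping.lookup p m * monom_eval z m)"
  by (rule poly_eval_superset) auto

lemma poly_eval_add: "poly_eval (p + q) z = poly_eval p z + poly_eval q z"
proof -
  let ?S = "Poly_Mapping.keys p \<union> Poly_Mapping.keys q"
  have "Poly_Mapping.keys (p + q) \<subseteq> ?S" by (rule keys_add)
  then show ?thesis
    by (simp add: poly_eval_superset[of ?S] lookup_add sum.distrib distrib_right)
qed

lemma poly_eval_zero: "poly_eval 0 z = 0"
  by (simp add: poly_eval_def)

lemma poly_eval_sum: "poly_eval (\<Sum>i\<in>I. f i) z = (\<Sum>i\<in>I. poly_eval (f i) z)"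
  by (induction I rule: infinite_finite_induct) (simp_all add: poly_eval_zero poly_eval_add)

lemma poly_eval_single: "poly_eval (Poly_Mapping.single m c) z = c * monom_eval z m"
  by (cases "c = 0") (simp_all add: poly_eval_zero poly_eval_monoms)

lemma sum_single_keys:
  fixes p :: "'a \<Rightarrow>\<^sub>0 'b::comm_monoid_add"
  shows "(\<Sum>m\<in>Poly_Mapping.keys p. Poly_Mapping.single m (Poly_Mapping.lookup p m)) = p"
proof (rule poly_mapping_eqI)
  fix k
  have "Poly_Mapping.lookup (\<Sum>m\<in>Poly_Mapping.keys p. Poly_Mapping.single m (Poly_Mapping.lookup p m)) k
    = (\<Sum>m\<in>Poly_Mapping.keys p. if m = k then Poly_Mapping.lookup p m else 0)"
    by (simp add: lookup_sum lookup_single when_def)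
  also have "\<dots> = Poly_Mapping.lookup p k" by (simp add: in_keys_iff)
  finally show "Poly_Mapping.lookup (\<Sum>m\<in>Poly_Mapping.keys p. Poly_Mapping.single m (Poly_Mapping.lookup p m)) k
    = Poly_Mapping.lookup p k" .
qed

lemma poly_eval_mult: "poly_eval (p * q) z = poly_eval p z * poly_eval q z"
proof -
  have "p * q = (\<Sum>m\<in>Poly_Mapping.keys p. Poly_Mapping.single m (Poly_Mapping.lookup p m)) *
     (\<Sum>m\<in>Poly_Mapping.keys q. Poly_Mapping.single m (Poly_Mapping.lookup q m))"
    by (simp only: sum_single_keys)
  also have "\<dots> = (\<Sum>m\<in>Poly_Mapping.keys p. \<Sum>m'\<in>Poly_Mapping.keys q.
     Poly_Mapping.single (m + m') (Poly_Mapping.lookup p m * Poly_Mapping.lookup q m'))"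
    by (simp add: sum_product mult_single)
  finally have "poly_eval (p * q) z = (\<Sum>m\<in>Poly_Mapping.keys p. \<Sum>m'\<in>Poly_Mapping.keys q.
     (Poly_Mapping.lookup p m * monom_eval z m) * (Poly_Mapping.lookup q m' * monom_eval z m'))"
    by (simp add: poly_eval_sum poly_eval_single monom_eval_add mult_ac)
  then show ?thesis by (simp add: poly_eval_monoms sum_product)
qed

text \<open>Polynomials are handled as functions, so that closure properties and substitutions can be stated
  pointwise.  The total degree is tracked because it bounds the number of monomials.\<close>

definition poly_fun :: "nat set \<Rightarrow> nat \<Rightarrow> ((nat \<Rightarrow> complex) \<Rightarrow> complex) \<Rightarrow> bool" where
  "poly_fun V k f \<longleftrightarrow> (\<exists>q. poly_vars q \<subseteq> V \<and> (\<forall>m\<in>Poly_Mapping.keys q. total_deg m \<le> k) \<and>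
     (\<forall>z. f z = poly_eval q z))"

lemma poly_fun_mono: "poly_fun V k f \<Longrightarrow> k \<le> l \<Longrightarrow> poly_fun V l f"
  unfolding poly_fun_def by (meson order_trans)

lemma poly_fun_const: "poly_fun V k (\<lambda>z. c)"
  unfolding poly_fun_def
  by (rule exI[of _ "Poly_Mapping.single 0 c"])
     (auto simp: poly_vars_def poly_eval_single monom_eval_def total_deg_def split: if_splits)

lemma poly_fun_var: "j \<in> V \<Longrightarrow> 1 \<le> k \<Longrightarrow> poly_fun V k (\<lambda>z. z j)"
  unfolding poly_fun_def
  by (rule exI[of _ "Poly_Mapping.single (Poly_Mapping.single j 1) 1"])
     (auto simp: poly_vars_def poly_eval_single monom_eval_def total_deg_def)

lemma keys_of_poly_vars:
  "poly_vars q \<subseteq> V \<Longrightarrow> m \<in> Poly_Mapping.keys q \<Longrightarrow> Poly_Mapping.keys m \<subseteq> V"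
  unfolding poly_vars_def by blast

lemma poly_vars_subsetI:
  "(\<And>m. m \<in> Poly_Mapping.keys q \<Longrightarrow> Poly_Mapping.keys m \<subseteq> V) \<Longrightarrow> poly_vars q \<subseteq> V"
  unfolding poly_vars_def by blast

lemma poly_fun_add:
  assumes "poly_fun V k f" "poly_fun V k g"
  shows "poly_fun V k (\<lambda>z. f z + g z)"
proof -
  from assms obtain p q where
    p: "poly_vars p \<subseteq> V" "\<And>m. m \<in> Poly_Mapping.keys p \<Longrightarrow> total_deg m \<le> k" "\<And>z. f z = poly_eval p z" and
    q: "poly_vars q \<subseteq> V" "\<And>m. m \<in> Poly_Mapping.keys q \<Longrightarrow> total_deg m \<le> k" "\<And>z. g z = poly_eval q z"
    unfolding poly_fun_def by blast
  have *: "Poly_Mapping.keys (p + q) \<subseteq> Poly_Mapping.keys p \<union> Poly_Mapping.keys q" by (rule keys_add)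
  have "poly_vars (p + q) \<subseteq> V"
    using * keys_of_poly_vars[OF p(1)] keys_of_poly_vars[OF q(1)] by (intro poly_vars_subsetI) blast
  moreover have "\<forall>m\<in>Poly_Mapping.keys (p + q). total_deg m \<le> k" using * p(2) q(2) by blast
  ultimately show ?thesis unfolding poly_fun_def
    by (intro exI[of _ "p + q"]) (simp only: poly_eval_add p(3) q(3) simp_thms)
qed

lemma poly_fun_mult:
  assumes "poly_fun V k f" "poly_fun V l g"
  shows "poly_fun V (k + l) (\<lambda>z. f z * g z)"
proof -
  from assms obtain p q where
    p: "poly_vars p \<subseteq> V" "\<And>m. m \<in> Poly_Mapping.keys p \<Longrightarrow> total_deg m \<le> k" "\<And>z. f z = poly_eval p z" and
    q: "poly_vars q \<subseteq> V" "\<And>m. m \<in> Poly_Mapping.keys q \<Longrightarrow> total_deg m \<le> l" "\<And>z. g z = poly_eval q z"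
    unfolding poly_fun_def by blast
  have *: "\<exists>a\<in>Poly_Mapping.keys p. \<exists>b\<in>Poly_Mapping.keys q. m = a + b"
    if "m \<in> Poly_Mapping.keys (p * q)" for m
    using keys_mult[of p q] that by blast
  have "poly_vars (p * q) \<subseteq> V"
  proof (rule poly_vars_subsetI)
    fix m assume "m \<in> Poly_Mapping.keys (p * q)"
    from *[OF this] obtain a b where ab: "a \<in> Poly_Mapping.keys p" "b \<in> Poly_Mapping.keys q" "m = a + b"
      by blast
    then show "Poly_Mapping.keys m \<subseteq> V"
      using keys_add[of a b] keys_of_poly_vars[OF p(1) ab(1)] keys_of_poly_vars[OF q(1) ab(2)] by blast
  qed
  moreover have "\<forall>m\<in>Poly_Mapping.keys (p * q). total_deg m \<le> k + l"
  proof
    fix m assume "m \<in> Poly_Mapping.keys (p * q)"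
    from *[OF this] obtain a b where ab: "a \<in> Poly_Mapping.keys p" "b \<in> Poly_Mapping.keys q" "m = a + b"
      by blast
    with p(2)[of a] q(2)[of b] show "total_deg m \<le> k + l" by (simp add: total_deg_add)
  qed
  ultimately show ?thesis unfolding poly_fun_def
    by (intro exI[of _ "p * q"]) (simp only: poly_eval_mult p(3) q(3) simp_thms)
qed

lemma poly_fun_uminus:
  assumes "poly_fun V k f"
  shows "poly_fun V k (\<lambda>z. - f z)"
  using poly_fun_mult[OF poly_fun_const[of V 0 "-1"] assms] by simp

lemma poly_fun_diff:
  assumes "poly_fun V k f" "poly_fun V k g"
  shows "poly_fun V k (\<lambda>z. f z - g z)"
  using poly_fun_add[OF assms(1) poly_fun_uminus[OF assms(2)]] by simp

lemma poly_fun_sum: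
  assumes "\<And>i. i \<in> I \<Longrightarrow> poly_fun V k (f i)"
  shows "poly_fun V k (\<lambda>z. \<Sum>i\<in>I. f i z)"
  using assms
proof (induction I rule: infinite_finite_induct)
  case (insert a I)
  have "poly_fun V k (\<lambda>z. f a z + (\<Sum>i\<in>I. f i z))"
    by (intro poly_fun_add) (use insert in auto)
  with insert.hyps show ?case by simp
qed (simp_all add: poly_fun_const)

lemma poly_fun_power:
  assumes "poly_fun V k f"
  shows "poly_fun V (n * k) (\<lambda>z. f z ^ n)"
proof (induction n)
  case (Suc n)
  from poly_fun_mult[OF assms Suc] show ?case by simp
qed (simp only: power_0 poly_fun_const)

lemma poly_fun_prod:
  assumes "\<And>i. i \<in> I \<Longrightarrow> poly_fun V (k i) (f i)"
  shows "poly_fun V (\<Sum>i\<in>I. k i) (\<lambda>z. \<Prod>i\<in>I. f i z)"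
  using assms
proof (induction I rule: infinite_finite_induct)
  case (insert a I)
  have "poly_fun V (k a + (\<Sum>i\<in>I. k i)) (\<lambda>z. f a z * (\<Prod>i\<in>I. f i z))"
    by (intro poly_fun_mult) (use insert in auto)
  with insert.hyps show ?case by simp
qed (simp_all add: poly_fun_const)

lemma poly_fun_monom:
  assumes "Poly_Mapping.keys m \<subseteq> V"
  shows "poly_fun V (total_deg m) (\<lambda>z. monom_eval z m)"
  unfolding monom_eval_def total_deg_def
proof (rule poly_fun_prod)
  fix j assume "j \<in> Poly_Mapping.keys m"
  then have "poly_fun V 1 (\<lambda>z. z j)" using assms by (intro poly_fun_var) auto
  then show "poly_fun V (Poly_Mapping.lookup m j) (\<lambda>z. z j ^ Poly_Mapping.lookup m j)"
    using poly_fun_power[of V 1 "\<lambda>z. z j" "Poly_Mapping.lookup m j"] by simp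
qed

lemma norm_monom_le_1:
  assumes "Poly_Mapping.keys m \<subseteq> V" "\<forall>j\<in>V. norm (w j) \<le> 1"
  shows "norm (monom_eval w m) \<le> 1"
  unfolding monom_eval_def prod_norm[symmetric]
  by (rule prod_le_1) (use assms in \<open>auto simp: norm_power power_le_one\<close>)

lemma monom_eval_scale: "monom_eval (\<lambda>j. t * w j) m = t ^ total_deg m * monom_eval w m"
  unfolding monom_eval_def total_deg_def by (simp add: power_mult_distrib prod.distrib power_sum)

lemma norm_poly_eval_le:
  assumes "poly_vars q \<subseteq> V" "\<forall>j\<in>V. norm (w j) \<le> 1"
  shows "norm (poly_eval q w) \<le> (\<Sum>m\<in>Poly_Mapping.keys q. norm (Poly_Mapping.lookup q m))"
  unfolding poly_eval_monoms
proof (rule sum_norm_le)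
  fix m assume "m \<in> Poly_Mapping.keys q"
  then have "norm (monom_eval w m) \<le> 1"
    using assms by (intro norm_monom_le_1[of m V] keys_of_poly_vars[of q])
  then show "norm (Poly_Mapping.lookup q m * monom_eval w m) \<le> norm (Poly_Mapping.lookup q m)"
    by (simp add: norm_mult mult_left_le)
qed

lemma monomial_eqI:
  assumes "Poly_Mapping.keys m \<subseteq> V" "Poly_Mapping.keys m' \<subseteq> V"
    and "\<forall>j\<in>V. Poly_Mapping.lookup m j = Poly_Mapping.lookup m' j"
  shows "m = m'"
proof (rule poly_mapping_eqI)
  fix j show "Poly_Mapping.lookup m j = Poly_Mapping.lookup m' j"
  proof (cases "j \<in> V")
    case False
    then have "j \<notin> Poly_Mapping.keys m" "j \<notin> Poly_Mapping.keys m'" using assms by blast+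
    then show ?thesis by (simp add: in_keys_iff)
  qed (use assms(3) in blast)
qed

text \<open>Polynomial growth of the number of monomials in the degree suffices below, since it competes with a
  geometrically decaying factor.\<close>

lemma card_monomials_le:
  assumes "finite V" "\<And>m. m \<in> S \<Longrightarrow> Poly_Mapping.keys m \<subseteq> V \<and> total_deg m \<le> k"
  shows "card S \<le> (k + 1) ^ card V"
proof -
  let ?r = "\<lambda>m::nat \<Rightarrow>\<^sub>0 nat. restrict (Poly_Mapping.lookup m) V"
  have "inj_on ?r S"
  proof (rule inj_onI)
    fix m m' assume m: "m \<in> S" "m' \<in> S" "?r m = ?r m'"
    have "\<forall>j\<in>V. Poly_Mapping.lookup m j = Poly_Mapping.lookup m' j"
    proof
      fix j assume "j \<in> V"
      then show "Poly_Mapping.lookup m j = Poly_Mapping.lookup m' j"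
        using fun_cong[OF m(3), of j] by simp
    qed
    then show "m = m'" by (rule monomial_eqI[rotated 2]) (use m assms(2) in blast)+
  qed
  moreover have "?r ` S \<subseteq> V \<rightarrow>\<^sub>E {..k}"
    using assms(2) order_trans[OF lookup_le_total_deg] by fastforce
  moreover have "finite (V \<rightarrow>\<^sub>E {..k})" using assms(1) by (intro finite_PiE) auto
  ultimately have "card S \<le> card (V \<rightarrow>\<^sub>E {..k})" by (rule card_inj_on_le)
  also have "\<dots> = (k + 1) ^ card V" using assms(1) by (simp add: card_PiE)
  finally show ?thesis .
qed

section \<open>Coefficient estimates\<close>

text \<open>Cauchy's estimate, stated for a given expansion instead of iterated derivatives.\<close>

lemma fps_coeff_bound:
  assumes "f has_fps_expansion F" "f holomorphic_on ball 0 r" "continuous_on (cball 0 r) f" "0 < r"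
    and "\<And>x. norm x = r \<Longrightarrow> norm (f x) \<le> B"
  shows "norm (fps_nth F k) \<le> B / r ^ k"
proof -
  have "F = fps_expansion f 0" using assms(1) by (metis fps_expansion_eqI)
  then have "fps_nth F k = (deriv ^^ k) f 0 / fact k" by (simp add: fps_expansion_def)
  moreover have "norm ((deriv ^^ k) f 0) \<le> fact k * B / r ^ k"
    using assms by (intro Cauchy_inequality) auto
  ultimately show ?thesis
    by (simp add: norm_divide pos_divide_le_eq mult.commute)
qed

lemma poly_has_fps_expansion:
  fixes c :: "'i \<Rightarrow> complex"
  assumes "finite S"
  shows "(\<lambda>t. \<Sum>i\<in>S. c i * t ^ e i) has_fps_expansion Abs_fps (\<lambda>k. \<Sum>i | i \<in> S \<and> e i = k. c i)"
proof -
  have "(\<lambda>t. \<Sum>i\<in>S. c i * t ^ e i) has_fps_expansion (\<Sum>i\<in>S. fps_const (c i) * fps_X ^ e i)"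
    by (intro fps_expansion_intros)
  moreover have "(\<Sum>i\<in>S. fps_const (c i) * fps_X ^ e i) = Abs_fps (\<lambda>k. \<Sum>i | i \<in> S \<and> e i = k. c i)"
  proof (rule fps_ext)
    fix k
    have "fps_nth (\<Sum>i\<in>S. fps_const (c i) * fps_X ^ e i) k = (\<Sum>i\<in>S. if e i = k then c i else 0)"
      unfolding fps_sum_nth by (intro sum.cong) auto
    also have "\<dots> = (\<Sum>i | i \<in> S \<and> e i = k. c i)"
      using assms by (simp add: sum.If_cases Int_def)
    finally show "fps_nth (\<Sum>i\<in>S. fps_const (c i) * fps_X ^ e i) k =
      fps_nth (Abs_fps (\<lambda>k. \<Sum>i | i \<in> S \<and> e i = k. c i)) k" by simp
  qed
  ultimately show ?thesis by simp
qed

lemma circle_coeff_bound: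
  fixes c :: "'i \<Rightarrow> complex"
  assumes "finite S" "\<And>t. norm t = 1 \<Longrightarrow> norm (\<Sum>i\<in>S. c i * t ^ e i) \<le> B"
  shows "norm (\<Sum>i | i \<in> S \<and> e i = k. c i) \<le> B"
proof -
  have "norm (fps_nth (Abs_fps (\<lambda>k. \<Sum>i | i \<in> S \<and> e i = k. c i)) k) \<le> B / 1 ^ k"
    by (rule fps_coeff_bound[OF poly_has_fps_expansion[OF assms(1)]])
       (use assms(2) in \<open>auto intro!: holomorphic_intros continuous_intros\<close>)
  then show ?thesis by simp
qed

text \<open>Cauchy's estimate in several variables, one variable at a time: for fixed values of the other
  variables, the part of the polynomial with a prescribed exponent in the variable \<open>a\<close> is a coefficient of
  a polynomial in that variable alone, hence obeys the same bound.  An abstract index set for the monomials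
  lets the induction forget the exponents of the variables already removed.\<close>

lemma torus_coeff_bound:
  fixes c :: "'i \<Rightarrow> complex" and e :: "'i \<Rightarrow> 'j \<Rightarrow> nat"
  assumes "finite J" "finite S"
    and "\<And>i i'. i \<in> S \<Longrightarrow> i' \<in> S \<Longrightarrow> (\<forall>j\<in>J. e i j = e i' j) \<Longrightarrow> i = i'"
    and "\<And>z. (\<forall>j. norm (z j) = 1) \<Longrightarrow> norm (\<Sum>i\<in>S. c i * (\<Prod>j\<in>J. z j ^ e i j)) \<le> B"
    and "i \<in> S"
  shows "norm (c i) \<le> B"
  using assms
proof (induction J arbitrary: S rule: finite_induct)
  case empty
  then have "S = {i}" by auto
  with empty.prems(3)[of "\<lambda>_. 1"] show ?case by simp
next
  case (insert a J)
  let ?S = "{i' \<in> S. e i' a = e i a}"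
  show ?case
  proof (rule insert.IH)
    show "finite ?S" "i \<in> ?S" using insert.prems by auto
  next
    fix i' i'' assume "i' \<in> ?S" "i'' \<in> ?S" "\<forall>j\<in>J. e i' j = e i'' j"
    then show "i' = i''" using insert.prems(2)[of i' i''] by auto
  next
    fix z :: "'j \<Rightarrow> complex" assume z: "\<forall>j. norm (z j) = 1"
    show "norm (\<Sum>i\<in>?S. c i * (\<Prod>j\<in>J. z j ^ e i j)) \<le> B"
    proof (rule circle_coeff_bound)
      fix t :: complex assume t: "norm t = 1"
      have "(\<Prod>j\<in>insert a J. (z(a := t)) j ^ e i j) = (\<Prod>j\<in>J. z j ^ e i j) * t ^ e i a" for i
      proof -
        have "(\<Prod>j\<in>J. (z(a := t)) j ^ e i j) = (\<Prod>j\<in>J. z j ^ e i j)"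
          using insert.hyps by (intro prod.cong) auto
        then show ?thesis using insert.hyps by simp
      qed
      moreover have "norm (\<Sum>i\<in>S. c i * (\<Prod>j\<in>insert a J. (z(a := t)) j ^ e i j)) \<le> B"
        using z t by (intro insert.prems(3)) auto
      ultimately show "norm (\<Sum>i\<in>S. c i * (\<Prod>j\<in>J. z j ^ e i j) * t ^ e i a) \<le> B"
        by (simp add: mult.assoc)
    qed (use insert.prems in auto)
  qed
qed

lemma l1_norm_le_torus_bound:
  assumes "finite V" "poly_vars q \<subseteq> V" "\<And>m. m \<in> Poly_Mapping.keys q \<Longrightarrow> total_deg m \<le> k"
    and "\<And>z. (\<forall>j. norm (z j) = 1) \<Longrightarrow> norm (poly_eval q z) \<le> B"
  shows "(\<Sum>m\<in>Poly_Mapping.keys q. norm (Poly_Mapping.lookup q m)) \<le> real ((k + 1) ^ card V) * B"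
proof -
  have keysV: "Poly_Mapping.keys m \<subseteq> V" if "m \<in> Poly_Mapping.keys q" for m
    using assms(2) that by (rule keys_of_poly_vars)
  have "0 \<le> B" using order_trans[OF norm_ge_zero assms(4)[of "\<lambda>_. 1"]] by simp
  have "norm (Poly_Mapping.lookup q m) \<le> B" if "m \<in> Poly_Mapping.keys q" for m
  proof (rule torus_coeff_bound[OF assms(1) finite_keys, of q Poly_Mapping.lookup])
    fix m m' assume m: "m \<in> Poly_Mapping.keys q" "m' \<in> Poly_Mapping.keys q"
      and eq: "\<forall>j\<in>V. Poly_Mapping.lookup m j = Poly_Mapping.lookup m' j"
    then show "m = m'" by (intro monomial_eqI[of m V m'] keysV)
  next
    fix z :: "nat \<Rightarrow> complex" assume "\<forall>j. norm (z j) = 1"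
    then have "norm (poly_eval q z) \<le> B" by (rule assms(4))
    then show "norm (\<Sum>m\<in>Poly_Mapping.keys q. Poly_Mapping.lookup q m *
        (\<Prod>j\<in>V. z j ^ Poly_Mapping.lookup m j)) \<le> B"
      using keysV by (simp add: poly_eval_monoms monom_eval_superset[OF assms(1)])
  qed fact
  then have "(\<Sum>m\<in>Poly_Mapping.keys q. norm (Poly_Mapping.lookup q m)) \<le> card (Poly_Mapping.keys q) * B"
    by (rule sum_bounded_above)
  moreover have "card (Poly_Mapping.keys q) \<le> (k + 1) ^ card V"
    by (rule card_monomials_le[OF assms(1)]) (use keysV assms(3) in blast)
  then have "real (card (Poly_Mapping.keys q)) * B \<le> real ((k + 1) ^ card V) * B"
    using \<open>0 \<le> B\<close> by (intro mult_right_mono) (simp_all only: of_nat_le_iff)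
  ultimately show ?thesis by (rule order_trans)
qed

section \<open>Approximating the reciprocal of a zero-free polynomial\<close>

lemma poly_over_exp_tendsto_0:
  assumes "1 < (r::real)"
  shows "(\<lambda>k. real ((D + k + 1) ^ n) * (C / r ^ k)) \<longlonglongrightarrow> 0"
proof -
  have *: "(\<lambda>k. real ((D + k + 1) ^ n) / s ^ k) \<longlonglongrightarrow> 0" if "1 < s" for s :: real
    using that
  proof (induction n arbitrary: s)
    case 0
    then show ?case
      using LIMSEQ_power_zero[of "1 / s"] by (simp add: power_one_over)
  next
    case (Suc n)
    \<comment> \<open>One factor of the power is absorbed by half of the exponential decay.\<close>
    define t where "t = sqrt s"
    have t: "1 < t" "t * t = s" using Suc.prems by (auto simp: t_def)
    have "(\<lambda>k. real k / t ^ k) \<longlonglongrightarrow> 0"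
      using powser_times_n_limit_0[of "1 / t"] t by (simp add: power_one_over)
    moreover have "(\<lambda>k. real (D + 1) * (1 / t) ^ k) \<longlonglongrightarrow> real (D + 1) * 0"
      using t by (intro tendsto_intros LIMSEQ_power_zero) auto
    ultimately have "(\<lambda>k. real k / t ^ k + real (D + 1) * (1 / t) ^ k) \<longlonglongrightarrow> 0 + real (D + 1) * 0"
      by (rule tendsto_add)
    from tendsto_mult[OF this Suc.IH[OF t(1)]]
    have "(\<lambda>k. (real k / t ^ k + real (D + 1) * (1 / t) ^ k) * (real ((D + k + 1) ^ n) / t ^ k)) \<longlonglongrightarrow> 0"
      by simp
    moreover have "(real k / t ^ k + real (D + 1) * (1 / t) ^ k) * (real ((D + k + 1) ^ n) / t ^ k)
        = real ((D + k + 1) ^ Suc n) / s ^ k" for k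
      unfolding t(2)[symmetric] power_mult_distrib using t(1)
      by (simp add: field_simps power_one_over)
    ultimately show ?case by simp
  qed
  have "(\<lambda>k. C * (real ((D + k + 1) ^ n) / r ^ k)) \<longlonglongrightarrow> C * 0"
    by (intro tendsto_intros * assms)
  then show ?thesis by (simp add: mult_ac)
qed

text \<open>Along the complex line through \<open>w\<close>, the function $t \mapsto 1/P(tw)$ is holomorphic on a disc of
  radius larger than $1$ and has a power series $\sum_k F_k(w) t^k$.  The recursion for the inverse of a
  power series shows that $F_k$ is a polynomial in \<open>w\<close> of degree at most \<open>k\<close>, and Cauchy's estimate bounds
  it by a constant times $r^{-k}$, uniformly for \<open>w\<close> in the closed unit polydisc.  The approximations are the partial sums
  at $t = 1$.\<close>

lemma inverse_polynomial_approximation: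
  assumes "poly_fun V D P" "1 < R" "0 < c"
    and lower: "\<And>w. (\<forall>j\<in>V. norm (w j) < R) \<Longrightarrow> c \<le> norm (P w)"
  obtains G r C where "1 < r" "\<And>k. poly_fun V k (G k)"
    "\<And>k w. (\<forall>j\<in>V. norm (w j) \<le> 1) \<Longrightarrow> norm (1 - P w * G k w) \<le> C / r ^ k"
    "\<And>k. P (\<lambda>_. 0) * G k (\<lambda>_. 0) = 1"
proof -
  obtain q where q: "poly_vars q \<subseteq> V" and Pq: "\<And>z. P z = poly_eval q z"
    using assms(1) unfolding poly_fun_def by blast
  define H where "H w = Abs_fps (\<lambda>k. \<Sum>m | m \<in> Poly_Mapping.keys q \<and> total_deg m = k.
      Poly_Mapping.lookup q m * monom_eval w m)" for w
  define F where "F w = inverse (H w)" for w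
  define G where "G k w = (\<Sum>i<Suc k. fps_nth (F w) i)" for k w
  define r where "r = (1 + R) / 2"
  have r: "1 < r" "r < R" using assms(2) by (auto simp: r_def)
  have line: "P (\<lambda>j. t * w j) =
      (\<Sum>m\<in>Poly_Mapping.keys q. Poly_Mapping.lookup q m * monom_eval w m * t ^ total_deg m)" for t w
    by (simp add: Pq poly_eval_monoms monom_eval_scale mult_ac)
  have H: "(\<lambda>t. P (\<lambda>j. t * w j)) has_fps_expansion H w" for w
    unfolding line H_def by (intro poly_has_fps_expansion) simp
  have P0: "P (\<lambda>_. 0) \<noteq> 0" using lower[of "\<lambda>_. 0"] assms(2,3) by auto
  have H0: "fps_nth (H w) 0 = P (\<lambda>_. 0)" for w
    using has_fps_expansion_imp_0_eq_fps_nth_0[OF H[of w]] by simp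
  have F: "(\<lambda>t. inverse (P (\<lambda>j. t * w j))) has_fps_expansion F w" for w
    unfolding F_def by (rule has_fps_expansion_inverse[OF H]) (simp add: H0 P0)
  have poly_H: "poly_fun V i (\<lambda>w. fps_nth (H w) i)" for i
    unfolding H_def fps_nth_Abs_fps
  proof (rule poly_fun_sum)
    fix m assume m: "m \<in> {m \<in> Poly_Mapping.keys q. total_deg m = i}"
    then have "poly_fun V (0 + total_deg m) (\<lambda>w. Poly_Mapping.lookup q m * monom_eval w m)"
      using q by (intro poly_fun_mult poly_fun_const poly_fun_monom keys_of_poly_vars[of q]) auto
    with m show "poly_fun V i (\<lambda>w. Poly_Mapping.lookup q m * monom_eval w m)" by simp
  qed
  \<comment> \<open>Comparing coefficients in \<open>H w * F w = 1\<close>.\<close>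
  have F_rec: "fps_nth (F w) n = - inverse (P (\<lambda>_. 0)) * (\<Sum>i=1..n. fps_nth (H w) i * fps_nth (F w) (n - i))"
    if "0 < n" for n w
  proof -
    have "H w * F w = 1" unfolding F_def mult.commute[of "H w"]
      by (rule inverse_mult_eq_1) (simp add: H0 P0)
    then have "0 = fps_nth (H w * F w) n" using that by simp
    also have "\<dots> = fps_nth (H w) 0 * fps_nth (F w) n + (\<Sum>i=1..n. fps_nth (H w) i * fps_nth (F w) (n - i))"
      by (simp add: fps_mult_nth sum.atLeast_Suc_atMost)
    finally show ?thesis using P0 by (simp add: H0 field_simps eq_neg_iff_add_eq_0)
  qed
  have poly_F: "poly_fun V n (\<lambda>w. fps_nth (F w) n)" for n
  proof (induction n rule: less_induct)
    case (less n)
    show ?case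
    proof (cases "n = 0")
      case True
      have "fps_nth (F w) 0 = inverse (P (\<lambda>_. 0))" for w by (simp add: F_def H0)
      with True show ?thesis by (simp add: poly_fun_const)
    next
      case False
      have "poly_fun V (0 + n) (\<lambda>w. - inverse (P (\<lambda>_. 0)) * (\<Sum>i=1..n. fps_nth (H w) i * fps_nth (F w) (n - i)))"
      proof (intro poly_fun_mult poly_fun_const poly_fun_sum)
        fix i assume i: "i \<in> {1..n}"
        then have "poly_fun V (i + (n - i)) (\<lambda>w. fps_nth (H w) i * fps_nth (F w) (n - i))"
          by (intro poly_fun_mult poly_H less.IH) auto
        with i show "poly_fun V n (\<lambda>w. fps_nth (H w) i * fps_nth (F w) (n - i))" by simp
      qed
      with False show ?thesis by (simp add: F_rec)
    qed
  qed
  define M where "M = (\<Sum>m\<in>Poly_Mapping.keys q. norm (Poly_Mapping.lookup q m))"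
  define K where "K = 1 / c / r * (1 / (1 - 1 / r))"
  have tail: "norm (inverse (P w) - G k w) \<le> K / r ^ k" if w: "\<forall>j\<in>V. norm (w j) \<le> 1" for k w
  proof -
    have low: "c \<le> norm (P (\<lambda>j. t * w j))" if "norm t < R" for t
    proof (rule lower, intro ballI)
      fix j assume "j \<in> V"
      then have "norm (t * w j) \<le> norm t * 1" using w by (simp add: norm_mult mult_left_le)
      with that show "norm (t * w j) < R" by simp
    qed
    have hol: "(\<lambda>t. inverse (P (\<lambda>j. t * w j))) holomorphic_on ball 0 R"
      unfolding line
    proof (intro holomorphic_intros)
      fix t assume "t \<in> ball (0::complex) R"
      then have "norm (P (\<lambda>j. t * w j)) \<noteq> 0" using low[of t] assms(3) by auto
      then show "(\<Sum>m\<in>Poly_Mapping.keys q. Poly_Mapping.lookup q m * monom_eval w m * t ^ total_deg m) \<noteq> 0"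
        unfolding line[symmetric] by simp
    qed
    have coeff: "norm (fps_nth (F w) i) \<le> 1 / c / r ^ i" for i
    proof (rule fps_coeff_bound[OF F])
      show "(\<lambda>t. inverse (P (\<lambda>j. t * w j))) holomorphic_on ball 0 r"
        using hol by (rule holomorphic_on_subset) (use r in auto)
      show "continuous_on (cball 0 r) (\<lambda>t. inverse (P (\<lambda>j. t * w j)))"
        using holomorphic_on_imp_continuous_on[OF hol] by (rule continuous_on_subset) (use r in auto)
      show "0 < r" using r by simp
      fix t :: complex assume "norm t = r"
      then have "c \<le> norm (P (\<lambda>j. t * w j))" using r by (intro low) simp
      then show "norm (inverse (P (\<lambda>j. t * w j))) \<le> 1 / c"
        unfolding norm_inverse inverse_eq_divide[symmetric] using assms(3) by (rule le_imp_inverse_le)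
    qed
    have "(\<lambda>i. fps_nth (F w) i * 1 ^ i) sums inverse (P (\<lambda>j. 1 * w j))"
      by (rule has_fps_expansion_imp_sums_complex[where r = "ereal R", OF F]) (use hol assms(2) in auto)
    then have "(\<lambda>i. fps_nth (F w) i) sums inverse (P w)" by simp
    then have 1: "(\<lambda>i. fps_nth (F w) (i + Suc k)) sums (inverse (P w) - G k w)"
      unfolding G_def by (rule sums_split_initial_segment)
    have "(\<lambda>i. 1 / c / r ^ Suc k * (1 / r) ^ i) sums (1 / c / r ^ Suc k * (1 / (1 - 1 / r)))"
      using r by (intro sums_mult geometric_sums) simp
    from norm_sums_le[OF 1 this] have "norm (inverse (P w) - G k w) \<le> 1 / c / r ^ Suc k * (1 / (1 - 1 / r))"
      using coeff[of "i + Suc k" for i] by (simp add: power_add power_one_over mult_ac)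
    then show ?thesis by (simp add: K_def mult_ac)
  qed
  have approx: "norm (1 - P w * G k w) \<le> M * K / r ^ k" if w: "\<forall>j\<in>V. norm (w j) \<le> 1" for k w
  proof -
    have "\<forall>j\<in>V. norm (w j) < R" using w assms(2) by force
    then have "P w \<noteq> 0" using lower[of w] assms(3) by auto
    then have "1 - P w * G k w = P w * (inverse (P w) - G k w)" by (simp add: field_simps)
    then have "norm (1 - P w * G k w) = norm (P w) * norm (inverse (P w) - G k w)"
      by (simp add: norm_mult)
    also have "\<dots> \<le> M * (K / r ^ k)"
      using tail[OF w] norm_poly_eval_le[OF q w] unfolding Pq[symmetric] M_def[symmetric]
      by (intro mult_mono) (auto simp: M_def intro: sum_nonneg)
    finally show ?thesis by simp
  qed
  \<comment> \<open>At \<open>w = 0\<close> the line is constant, so its expansion has no higher terms.\<close>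
  have at_0: "P (\<lambda>_. 0) * G k (\<lambda>_. 0) = 1" for k
  proof -
    have "(\<lambda>t. P (\<lambda>j. t * 0)) has_fps_expansion fps_const (P (\<lambda>_. 0))" by simp
    with H[of "\<lambda>_. 0"] have "H (\<lambda>_. 0) = fps_const (P (\<lambda>_. 0))" by (metis fps_expansion_eqI)
    then have "F (\<lambda>_. 0) = fps_const (inverse (P (\<lambda>_. 0)))" by (simp add: F_def fps_const_inverse)
    then have "G k (\<lambda>_. 0) = inverse (P (\<lambda>_. 0))" by (simp add: G_def sum.lessThan_Suc_shift)
    then show ?thesis using P0 by simp
  qed
  have "poly_fun V k (G k)" for k
    unfolding G_def by (intro poly_fun_sum poly_fun_mono[OF poly_F]) auto
  from that[OF r(1) this approx at_0] show ?thesis .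
qed

lemma poly_eval_0: "poly_eval q (\<lambda>_. 0) = Poly_Mapping.lookup q 0"
proof -
  have "monom_eval (\<lambda>_. 0) m = (if m = 0 then 1 else 0)" for m
  proof (cases "m = 0")
    case False
    then obtain j where "j \<in> Poly_Mapping.keys m" by fastforce
    then show ?thesis unfolding monom_eval_def using False by (auto simp: in_keys_iff intro!: prod_zero)
  qed (simp add: monom_eval_def)
  then have "poly_eval q (\<lambda>_. 0) = (\<Sum>m\<in>Poly_Mapping.keys q. if m = 0 then Poly_Mapping.lookup q m else 0)"
    unfolding poly_eval_monoms by (intro sum.cong) auto
  then show ?thesis by (simp add: in_keys_iff)
qed

text \<open>For the partial sum \<open>G\<close> of degree \<open>k\<close>, the supremum of $|1 - PG|$ on the torus decays geometrically
  in \<open>k\<close>.  By Cauchy's estimate so does each coefficient, and as there are only polynomially many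
  coefficients, their sum becomes small.\<close>

lemma multiple_close_to_1:
  assumes "finite V" "poly_fun V D P" "1 < R" "0 < c"
    and lower: "\<And>w. (\<forall>j\<in>V. norm (w j) < R) \<Longrightarrow> c \<le> norm (P w)"
  obtains e G h where "poly_fun V e G" "poly_vars h \<subseteq> V" "0 \<notin> Poly_Mapping.keys h"
    "(\<Sum>m\<in>Poly_Mapping.keys h. norm (Poly_Mapping.lookup h m)) \<le> 1"
    "\<And>w. P w * G w = 1 - poly_eval h w"
proof -
  show ?thesis
  proof (rule inverse_polynomial_approximation[OF assms(2-4)])
    show "c \<le> norm (P w)" if "\<forall>j\<in>V. norm (w j) < R" for w using that by (rule lower)
  next
    fix G and r C :: real
    assume r: "1 < r" and G: "\<And>k. poly_fun V k (G k)"
      and approx: "\<And>k w. (\<forall>j\<in>V. norm (w j) \<le> 1) \<Longrightarrow> norm (1 - P w * G k w) \<le> C / r ^ k"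
      and at_0: "\<And>k. P (\<lambda>_. 0) * G k (\<lambda>_. 0) = 1"
    have "\<forall>\<^sub>F k in sequentially. real ((D + k + 1) ^ card V) * (C / r ^ k) < 1"
      using poly_over_exp_tendsto_0[OF r, of D "card V" C] by (rule order_tendstoD) simp
    then obtain k where k: "real ((D + k + 1) ^ card V) * (C / r ^ k) < 1"
      by (auto simp: eventually_sequentially)
    have "poly_fun V (D + k) (\<lambda>w. 1 - P w * G k w)"
      by (intro poly_fun_diff poly_fun_const poly_fun_mult assms(2) G)
    then obtain h where h: "poly_vars h \<subseteq> V" "\<And>m. m \<in> Poly_Mapping.keys h \<Longrightarrow> total_deg m \<le> D + k"
      "\<And>w. 1 - P w * G k w = poly_eval h w"
      unfolding poly_fun_def by blast
    have "(\<Sum>m\<in>Poly_Mapping.keys h. norm (Poly_Mapping.lookup h m)) \<le> real ((D + k + 1) ^ card V) * (C / r ^ k)"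
      by (rule l1_norm_le_torus_bound[OF assms(1) h(1,2)]) (auto simp: h(3)[symmetric] intro!: approx)
    moreover have "0 \<notin> Poly_Mapping.keys h"
      using h(3)[of "\<lambda>_. 0"] by (simp add: at_0 poly_eval_0 in_keys_iff)
    moreover have "P w * G k w = 1 - poly_eval h w" for w using h(3)[of w] by (simp add: algebra_simps)
    ultimately show ?thesis using k by (intro that[OF G h(1)]) auto
  qed
qed

section \<open>Networks of words\<close>

text \<open>The vertices of the network are the letters of all words, in order; vertex \<open>i\<close> carries the variable
  \<open>L ! i\<close>.  The flag \<open>a i\<close> says that \<open>i\<close> continues the word of \<open>i - 1\<close>.  The weights \<open>b\<close> live on first
  letters and \<open>c\<close> on last letters, and both have modulus $\sqrt{|\kappa|}$ there.  The recursion for \<open>y\<close>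
  multiplies up the letters of each word, so that the last vertex of a word \<open>u\<close> receives the entry weight
  times the monomial of \<open>u\<close>.\<close>

lemma word_network_exists:
  fixes ws :: "(complex \<times> 'v list) list"
  assumes "\<forall>(\<kappa>, u)\<in>set ws. u \<noteq> []"
  defines "L \<equiv> concat (map snd ws)"
  shows "\<exists>a b c. \<not> a 0 \<and> (\<forall>i. a i \<longrightarrow> b i = 0) \<and> (\<forall>j. Suc j < length L \<longrightarrow> a (Suc j) \<longrightarrow> c j = 0) \<and>
    (\<Sum>i<length L. (norm (b i))\<^sup>2) = (\<Sum>(\<kappa>, u)\<leftarrow>ws. norm \<kappa>) \<and>
    (\<Sum>i<length L. (norm (c i))\<^sup>2) = (\<Sum>(\<kappa>, u)\<leftarrow>ws. norm \<kappa>) \<and>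
    (\<forall>(w :: 'v \<Rightarrow> complex) y. (\<forall>i<length L. y i = w (L ! i) * (b i + (if a i then y (i - 1) else 0))) \<longrightarrow>
       (\<Sum>i<length L. c i * y i) = (\<Sum>(\<kappa>, u)\<leftarrow>ws. \<kappa> * (\<Prod>x\<leftarrow>u. w x)))"
  using assms(1) unfolding L_def
proof (induction ws rule: rev_induct)
  case Nil
  show ?case by (intro exI[of _ "\<lambda>_. False"] exI[of _ "\<lambda>_. 0"]) simp
next
  case (snoc wd ws)
  obtain \<kappa> u where wd: "wd = (\<kappa>, u)" by fastforce
  define L where "L = concat (map snd ws)"
  define N where "N = length L"
  define m where "m = length u"
  have m: "0 < m" using snoc.prems wd by (simp add: m_def)
  obtain a b c where a0: "\<not> a 0" and ab: "\<And>i. a i \<Longrightarrow> b i = 0"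
    and ac: "\<And>j. Suc j < N \<Longrightarrow> a (Suc j) \<Longrightarrow> c j = 0"
    and b: "(\<Sum>i<N. (norm (b i))\<^sup>2) = (\<Sum>(\<kappa>, u)\<leftarrow>ws. norm \<kappa>)"
    and c: "(\<Sum>i<N. (norm (c i))\<^sup>2) = (\<Sum>(\<kappa>, u)\<leftarrow>ws. norm \<kappa>)"
    and y: "\<And>(w :: 'v \<Rightarrow> complex) y. (\<forall>i<N. y i = w (L ! i) * (b i + (if a i then y (i - 1) else 0))) \<Longrightarrow>
       (\<Sum>i<N. c i * y i) = (\<Sum>(\<kappa>, u)\<leftarrow>ws. \<kappa> * (\<Prod>x\<leftarrow>u. w x))"
    using snoc.IH snoc.prems unfolding N_def L_def by auto
  \<comment> \<open>If \<open>\<kappa> = 0\<close> then also \<open>\<gamma> = 0\<close>, by the convention for division by zero.\<close>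
  define \<beta> where "\<beta> = complex_of_real (sqrt (norm \<kappa>))"
  define \<gamma> where "\<gamma> = \<kappa> / \<beta>"
  have \<beta>\<gamma>: "\<gamma> * \<beta> = \<kappa>" "(norm \<beta>)\<^sup>2 = norm \<kappa>" "(norm \<gamma>)\<^sup>2 = norm \<kappa>"
    by (auto simp: \<gamma>_def \<beta>_def norm_divide power_divide power2_eq_square)
  define a' where "a' i = (if i < N then a i else i > N)" for i
  define b' where "b' i = (if i < N then b i else if i = N then \<beta> else 0)" for i
  define c' where "c' i = (if i < N then c i else if i = N + m - 1 then \<gamma> else 0)" for i
  have split: "(\<Sum>i<N + m. f i) = (\<Sum>i<N. f i) + (\<Sum>l<m. f (N + l))" for f :: "nat \<Rightarrow> 'x::comm_monoid_add"
    by (induction m) (simp_all add: add.assoc)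
  have "(\<Sum>l<m. (norm (b' (N + l)))\<^sup>2) = (\<Sum>l<m. if l = 0 then norm \<kappa> else 0)"
    by (intro sum.cong) (auto simp: b'_def \<beta>\<gamma>)
  then have b'_sum: "(\<Sum>i<N + m. (norm (b' i))\<^sup>2) = (\<Sum>(\<kappa>, u)\<leftarrow>ws @ [wd]. norm \<kappa>)"
    using b m by (simp add: split b'_def wd)
  have "(\<Sum>l<m. (norm (c' (N + l)))\<^sup>2) = (\<Sum>l<m. if l = m - 1 then norm \<kappa> else 0)"
    using m by (intro sum.cong) (auto simp: c'_def \<beta>\<gamma>)
  then have c'_sum: "(\<Sum>i<N + m. (norm (c' i))\<^sup>2) = (\<Sum>(\<kappa>, u)\<leftarrow>ws @ [wd]. norm \<kappa>)"
    using c m by (simp add: split c'_def wd)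
  have y': "(\<Sum>i<N + m. c' i * y' i) = (\<Sum>(\<kappa>, u)\<leftarrow>ws @ [wd]. \<kappa> * (\<Prod>x\<leftarrow>u. w x))"
    if rec: "\<forall>i<N + m. y' i = w ((L @ u) ! i) * (b' i + (if a' i then y' (i - 1) else 0))"
    for w :: "'v \<Rightarrow> complex" and y'
  proof -
    have "\<forall>i<N. y' i = w (L ! i) * (b i + (if a i then y' (i - 1) else 0))"
      using rec by (auto simp: nth_append N_def[symmetric] a'_def b'_def)
    then have 1: "(\<Sum>i<N. c i * y' i) = (\<Sum>(\<kappa>, u)\<leftarrow>ws. \<kappa> * (\<Prod>x\<leftarrow>u. w x))" by (rule y)
    have "l < m \<Longrightarrow> y' (N + l) = \<beta> * (\<Prod>x\<leftarrow>take (Suc l) u. w x)" for l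
    proof (induction l)
      case 0
      obtain x us where u: "u = x # us" using m by (cases u) (auto simp: m_def)
      have "y' N = w ((L @ u) ! N) * (b' N + (if a' N then y' (N - 1) else 0))" using rec m by simp
      moreover have "(L @ u) ! N = x" by (simp add: N_def u)
      moreover have "b' N = \<beta>" "\<not> a' N" by (simp_all add: a'_def b'_def)
      ultimately show ?case by (simp add: u)
    next
      case (Suc l)
      have "y' (N + Suc l) = w ((L @ u) ! (N + Suc l)) *
          (b' (N + Suc l) + (if a' (N + Suc l) then y' (N + Suc l - 1) else 0))"
        by (rule rec[rule_format]) (use Suc.prems in simp)
      moreover have "(L @ u) ! (N + Suc l) = u ! Suc l" unfolding N_def by (rule nth_append_length_plus)
      moreover have "b' (N + Suc l) + (if a' (N + Suc l) then y' (N + Suc l - 1) else 0) = y' (N + l)"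
        by (simp add: a'_def b'_def)
      moreover have "y' (N + l) = \<beta> * (\<Prod>x\<leftarrow>take (Suc l) u. w x)"
        by (rule Suc.IH) (use Suc.prems in simp)
      ultimately have "y' (N + Suc l) = w (u ! Suc l) * (\<beta> * (\<Prod>x\<leftarrow>take (Suc l) u. w x))"
        by (simp only:)
      also have "\<dots> = \<beta> * (\<Prod>x\<leftarrow>take (Suc (Suc l)) u. w x)"
        using Suc.prems by (subst (2) take_Suc_conv_app_nth) (simp_all add: m_def mult_ac)
      finally show ?case .
    qed
    from this[of "m - 1"] have "y' (N + m - 1) = \<beta> * (\<Prod>x\<leftarrow>u. w x)" using m by (simp add: m_def)
    moreover have "(\<Sum>l<m. c' (N + l) * y' (N + l)) = (\<Sum>l<m. if l = m - 1 then \<gamma> * y' (N + m - 1) else 0)"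
      using m by (intro sum.cong) (auto simp: c'_def)
    ultimately have "(\<Sum>l<m. c' (N + l) * y' (N + l)) = \<gamma> * \<beta> * (\<Prod>x\<leftarrow>u. w x)"
      using m by simp
    then have 2: "(\<Sum>l<m. c' (N + l) * y' (N + l)) = \<kappa> * (\<Prod>x\<leftarrow>u. w x)" by (simp only: \<beta>\<gamma>)
    have "(\<Sum>i<N. c' i * y' i) = (\<Sum>i<N. c i * y' i)" by (simp add: c'_def)
    with 1 2 show ?thesis by (simp add: split wd)
  qed
  have L': "concat (map snd (ws @ [wd])) = L @ u" "length (L @ u) = N + m"
    by (simp_all add: L_def wd N_def m_def)
  have a0': "\<not> a' 0" using a0 by (simp add: a'_def)
  have ab': "\<forall>i. a' i \<longrightarrow> b' i = 0" using ab by (auto simp: a'_def b'_def)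
  have ac': "\<forall>j. Suc j < N + m \<longrightarrow> a' (Suc j) \<longrightarrow> c' j = 0"
    using ac by (auto simp: a'_def c'_def)
  show ?case unfolding L'
    by (intro exI[of _ a'] exI[of _ b'] exI[of _ c'] conjI)
       (rule a0', rule ab', rule ac', rule b'_sum, rule c'_sum, intro allI impI, rule y', assumption)
qed

text \<open>Matrices are given here by their entries, so that no dimension conditions arise.\<close>

definition contraction :: "nat \<Rightarrow> (nat \<Rightarrow> nat \<Rightarrow> complex) \<Rightarrow> bool" where
  "contraction N K \<longleftrightarrow> (\<forall>u. (\<Sum>i<N. (norm (\<Sum>j<N. K i j * u j))\<^sup>2) \<le> (\<Sum>i<N. (norm (u i))\<^sup>2))"

lemma norm_sum_mult_le:
  fixes c u :: "nat \<Rightarrow> complex"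
  shows "(norm (\<Sum>j\<in>S. c j * u j))\<^sup>2 \<le> (\<Sum>j\<in>S. (norm (c j))\<^sup>2) * (\<Sum>j\<in>S. (norm (u j))\<^sup>2)"
proof -
  have "norm (\<Sum>j\<in>S. c j * u j) \<le> (\<Sum>j\<in>S. norm (c j) * norm (u j))"
    by (rule sum_norm_le) (simp add: norm_mult)
  then have "(norm (\<Sum>j\<in>S. c j * u j))\<^sup>2 \<le> (\<Sum>j\<in>S. norm (c j) * norm (u j))\<^sup>2"
    by (intro power_mono) auto
  also have "\<dots> \<le> (\<Sum>j\<in>S. (norm (c j))\<^sup>2) * (\<Sum>j\<in>S. (norm (u j))\<^sup>2)"
    by (rule Cauchy_Schwarz_ineq_sum)
  finally show ?thesis .
qed

text \<open>The entries of \<open>u\<close> that are not at the end of a word are shifted isometrically to the vertices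
  that continue a word; \<open>S\<close> is the set of their indices.  The remaining entries only enter through the scalar
  \<open>s\<close>, which is distributed with the weights \<open>b\<close> over the first letters.  These two groups of rows are
  disjoint, and Cauchy--Schwarz bounds the second one.\<close>

lemma network_contraction:
  fixes b c :: "nat \<Rightarrow> complex"
  assumes a0: "\<not> a 0" and ab: "\<And>i. a i \<Longrightarrow> b i = 0"
    and ac: "\<And>j. Suc j < N \<Longrightarrow> a (Suc j) \<Longrightarrow> c j = 0"
    and b: "(\<Sum>i<N. (norm (b i))\<^sup>2) \<le> 1" and c: "(\<Sum>i<N. (norm (c i))\<^sup>2) \<le> 1"
  shows "contraction N (\<lambda>i j. (if a i \<and> i = Suc j then 1 else 0) + b i * c j)"
  unfolding contraction_def
proof
  fix u :: "nat \<Rightarrow> complex"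
  define s where "s = (\<Sum>j<N. c j * u j)"
  define S where "S = {j. Suc j < N \<and> a (Suc j)}"
  have S: "S \<subseteq> {..<N}" "finite S" unfolding S_def by (auto intro: finite_subset[of _ "{..<N}"])
  have row: "(\<Sum>j<N. ((if a i \<and> i = Suc j then 1 else 0) + b i * c j) * u j)
      = (if a i then u (i - 1) else b i * s)" if "i < N" for i
  proof -
    have "(\<Sum>j<N. ((if a i \<and> i = Suc j then 1 else 0) + b i * c j) * u j)
       = (\<Sum>j<N. if a i \<and> i = Suc j then u j else 0) + b i * s"
      unfolding s_def sum_distrib_left sum.distrib[symmetric]
      by (intro sum.cong) (auto simp: algebra_simps)
    also have "(\<Sum>j<N. if a i \<and> i = Suc j then u j else 0) = (if a i then u (i - 1) else 0)"
    proof (cases "a i")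
      case True
      then obtain k where "i = Suc k" using a0 by (cases i) auto
      with True that show ?thesis by simp
    qed simp
    finally show ?thesis using ab by simp
  qed
  have "s = (\<Sum>j\<in>{..<N} - S. c j * u j)"
    unfolding s_def by (rule sum.mono_neutral_right) (use S ac in \<open>auto simp: S_def\<close>)
  then have "(norm s)\<^sup>2 \<le> (\<Sum>j\<in>{..<N} - S. (norm (c j))\<^sup>2) * (\<Sum>j\<in>{..<N} - S. (norm (u j))\<^sup>2)"
    by (simp only: norm_sum_mult_le)
  also have "(\<Sum>j\<in>{..<N} - S. (norm (c j))\<^sup>2) \<le> 1"
    using c by (rule order_trans[rotated]) (auto intro: sum_mono2)
  then have "(\<Sum>j\<in>{..<N} - S. (norm (c j))\<^sup>2) * (\<Sum>j\<in>{..<N} - S. (norm (u j))\<^sup>2)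
     \<le> 1 * (\<Sum>j\<in>{..<N} - S. (norm (u j))\<^sup>2)"
    by (intro mult_right_mono sum_nonneg) auto
  finally have s: "(norm s)\<^sup>2 \<le> (\<Sum>j\<in>{..<N} - S. (norm (u j))\<^sup>2)" by simp
  have "(\<Sum>i<N. (norm (\<Sum>j<N. ((if a i \<and> i = Suc j then 1 else 0) + b i * c j) * u j))\<^sup>2)
     = (\<Sum>i<N. (if a i then (norm (u (i - 1)))\<^sup>2 else 0) + (norm (b i))\<^sup>2 * (norm s)\<^sup>2)"
    using ab by (intro sum.cong) (auto simp: row norm_mult power_mult_distrib)
  also have "\<dots> = (\<Sum>i<N. if a i then (norm (u (i - 1)))\<^sup>2 else 0) + (\<Sum>i<N. (norm (b i))\<^sup>2) * (norm s)\<^sup>2"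
    by (simp add: sum.distrib sum_distrib_right)
  also have "(\<Sum>i<N. if a i then (norm (u (i - 1)))\<^sup>2 else 0) = (\<Sum>j\<in>S. (norm (u j))\<^sup>2)"
  proof -
    have "(\<Sum>i<N. if a i then (norm (u (i - 1)))\<^sup>2 else 0) = (\<Sum>i\<in>Suc ` S. (norm (u (i - 1)))\<^sup>2)"
    proof (rule sum.mono_neutral_cong_right)
      show "\<forall>i\<in>{..<N} - Suc ` S. (if a i then (norm (u (i - 1)))\<^sup>2 else 0) = 0"
      proof
        fix i assume i: "i \<in> {..<N} - Suc ` S"
        have "\<not> a i"
        proof
          assume "a i"
          then obtain k where k: "i = Suc k" using a0 by (cases i) auto
          with i \<open>a i\<close> have "k \<in> S" by (simp add: S_def)
          with i k show False by blast
        qed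
        then show "(if a i then (norm (u (i - 1)))\<^sup>2 else 0) = 0" by simp
      qed
    qed (auto simp: S_def)
    also have "\<dots> = (\<Sum>j\<in>S. (norm (u j))\<^sup>2)" by (subst sum.reindex) auto
    finally show ?thesis .
  qed
  also have "(\<Sum>j\<in>S. (norm (u j))\<^sup>2) + (\<Sum>i<N. (norm (b i))\<^sup>2) * (norm s)\<^sup>2
     \<le> (\<Sum>j\<in>S. (norm (u j))\<^sup>2) + 1 * (\<Sum>j\<in>{..<N} - S. (norm (u j))\<^sup>2)"
    using b s by (intro add_left_mono mult_mono) auto
  also have "\<dots> = (\<Sum>j<N. (norm (u j))\<^sup>2)"
    using S by (simp add: sum.subset_diff[of S "{..<N}"])
  finally show "(\<Sum>i<N. (norm (\<Sum>j<N. ((if a i \<and> i = Suc j then 1 else 0) + b i * c j) * u j))\<^sup>2)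
      \<le> (\<Sum>i<N. (norm (u i))\<^sup>2)" .
qed

text \<open>Both sides are the determinant of the bordered matrix with rows $(1, x)$ and $(y, 1)$,
  computed with the Schur complement of either diagonal block.\<close>

lemma det_one_minus_rank_one:
  fixes x y :: "nat \<Rightarrow> 'a::idom"
  shows "det (mat N N (\<lambda>(i, j). (if i = j then 1 else 0) - x i * y j)) = 1 - (\<Sum>i<N. y i * x i)"
proof -
  define X where "X = mat N 1 (\<lambda>(i, _). x i)"
  define Y where "Y = mat 1 N (\<lambda>(_, j). y j)"
  define R where "R = mat N N (\<lambda>(i, j). (if i = j then 1 else 0) - x i * y j)"
  define S where "S = mat 1 1 (\<lambda>_. 1 - (\<Sum>i<N. y i * x i))"
  have c[simp]: "X \<in> carrier_mat N 1" "Y \<in> carrier_mat 1 N" "R \<in> carrier_mat N N" "S \<in> carrier_mat 1 1"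
    by (auto simp: X_def Y_def R_def S_def)
  let ?L = "four_block_mat (1\<^sub>m N) (0\<^sub>m N 1) Y (1\<^sub>m 1)"
  have "four_block_mat R X (0\<^sub>m 1 N) (1\<^sub>m 1) * ?L = four_block_mat (1\<^sub>m N) X Y (1\<^sub>m 1)"
  proof -
    have "R * 1\<^sub>m N + X * Y = 1\<^sub>m N" "R * 0\<^sub>m N 1 + X * 1\<^sub>m 1 = X"
      "0\<^sub>m 1 N * 1\<^sub>m N + 1\<^sub>m 1 * Y = Y" "0\<^sub>m 1 N * 0\<^sub>m N 1 + 1\<^sub>m 1 * 1\<^sub>m 1 = (1\<^sub>m 1 :: 'a mat)"
      by (rule eq_matI; auto simp: R_def X_def Y_def scalar_prod_def)+
    then show ?thesis
      by (subst mult_four_block_mat[of _ N N _ 1 _ 1 _ _ N _ 1]) (simp_all only: c one_carrier_mat zero_carrier_mat)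
  qed
  moreover have "?L * four_block_mat (1\<^sub>m N) X (0\<^sub>m 1 N) S = four_block_mat (1\<^sub>m N) X Y (1\<^sub>m 1)"
  proof -
    have "1\<^sub>m N * 1\<^sub>m N + 0\<^sub>m N 1 * 0\<^sub>m 1 N = (1\<^sub>m N :: 'a mat)" "1\<^sub>m N * X + 0\<^sub>m N 1 * S = X"
      "Y * 1\<^sub>m N + 1\<^sub>m 1 * 0\<^sub>m 1 N = Y" "Y * X + 1\<^sub>m 1 * S = 1\<^sub>m 1"
      by (rule eq_matI; auto simp: S_def X_def Y_def scalar_prod_def atLeast0LessThan)+
    then show ?thesis
      by (subst mult_four_block_mat[of _ N N _ 1 _ 1 _ _ N _ 1]) (simp_all only: c one_carrier_mat zero_carrier_mat)
  qed
  ultimately have "det (four_block_mat R X (0\<^sub>m 1 N) (1\<^sub>m 1) * ?L) = det (?L * four_block_mat (1\<^sub>m N) X (0\<^sub>m 1 N) S)"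
    by simp
  moreover have "det ?L = 1"
    by (subst det_four_block_mat_upper_right_zero[of _ N _ 1]) (simp_all only: c one_carrier_mat det_one mult_1_left)
  moreover have "det (four_block_mat R X (0\<^sub>m 1 N) (1\<^sub>m 1)) = det R"
    by (subst det_four_block_mat_lower_left_zero[of _ N _ 1]) (simp_all only: c one_carrier_mat det_one mult_1_right)
  moreover have "det S = 1 - (\<Sum>i<N. y i * x i)"
    by (subst det_single[OF c(4)]) (simp add: S_def)
  then have "det (four_block_mat (1\<^sub>m N) X (0\<^sub>m 1 N) S) = 1 - (\<Sum>i<N. y i * x i)"
    by (subst det_four_block_mat_lower_left_zero[of _ N _ 1]) (simp_all only: c one_carrier_mat det_one mult_1_left)
  moreover have "det (four_block_mat R X (0\<^sub>m 1 N) (1\<^sub>m 1) * ?L)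
      = det (four_block_mat R X (0\<^sub>m 1 N) (1\<^sub>m 1)) * det ?L"
    by (intro det_mult[of _ "N + 1"] four_block_carrier_mat c one_carrier_mat)
  moreover have "det (?L * four_block_mat (1\<^sub>m N) X (0\<^sub>m 1 N) S)
      = det ?L * det (four_block_mat (1\<^sub>m N) X (0\<^sub>m 1 N) S)"
    by (intro det_mult[of _ "N + 1"] four_block_carrier_mat c one_carrier_mat)
  ultimately show ?thesis by (simp add: R_def)
qed

text \<open>With \<open>T\<close> the part of the matrix without the rank-one term \<open>b\<close> times \<open>c\<close>, the recursion says
  that \<open>y\<close> solves \<open>T y = w b\<close> (with the entrywise product \<open>w b\<close>).  So the matrix factors as \<open>T\<close> times
  the rank-one perturbation of the identity by \<open>y\<close> and \<open>c\<close>, and \<open>T\<close> is triangular with unit diagonal.\<close>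

lemma det_network:
  fixes b c w y :: "nat \<Rightarrow> complex"
  assumes a0: "\<not> a 0"
    and y: "\<And>i. i < N \<Longrightarrow> y i = w i * (b i + (if a i then y (i - 1) else 0))"
  shows "det (mat N N (\<lambda>(i, j). (if i = j then 1 else 0) -
      w i * ((if a i \<and> i = Suc j then 1 else 0) + b i * c j))) = 1 - (\<Sum>i<N. c i * y i)"
proof -
  define T where "T = mat N N (\<lambda>(i, j). (if i = j then 1 else 0) - w i * (if a i \<and> i = Suc j then 1 else 0))"
  define R where "R = mat N N (\<lambda>(i, j). (if i = j then 1 else 0) - y i * c j)"
  have "mat N N (\<lambda>(i, j). (if i = j then 1 else 0) - w i * ((if a i \<and> i = Suc j then 1 else 0) + b i * c j))
     = T * R"
  proof (rule eq_matI)
    fix i j assume "i < dim_row (T * R)" "j < dim_col (T * R)"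
    then have ij: "i < N" "j < N" by (auto simp: T_def R_def)
    have "(T * R) $$ (i, j) = (\<Sum>k<N. T $$ (i, k) * R $$ (k, j))"
      using ij by (simp add: T_def R_def scalar_prod_def atLeast0LessThan)
    also have "\<dots> = (\<Sum>k<N. (if k = j then T $$ (i, k) else 0) - T $$ (i, k) * y k * c j)"
      using ij by (intro sum.cong) (auto simp: R_def algebra_simps)
    also have "\<dots> = T $$ (i, j) - (\<Sum>k<N. T $$ (i, k) * y k) * c j"
      using ij by (simp add: sum_subtractf sum_distrib_right)
    also have "(\<Sum>k<N. T $$ (i, k) * y k) = (\<Sum>k<N. (if k = i then y k else 0) - w i * (if a i \<and> i = Suc k then y k else 0))"
      using ij by (intro sum.cong) (auto simp: T_def algebra_simps)
    also have "\<dots> = y i - w i * (\<Sum>k<N. if a i \<and> i = Suc k then y k else 0)"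
      using ij by (simp add: sum_subtractf sum_distrib_left)
    also have "(\<Sum>k<N. if a i \<and> i = Suc k then y k else 0) = (if a i then y (i - 1) else 0)"
    proof (cases "a i")
      case True
      then obtain k where "i = Suc k" using a0 by (cases i) auto
      with True ij show ?thesis by simp
    qed simp
    also have "y i - w i * (if a i then y (i - 1) else 0) = w i * b i"
      using y[OF ij(1)] by (simp add: distrib_left)
    finally show "mat N N (\<lambda>(i, j). (if i = j then 1 else 0) - w i * ((if a i \<and> i = Suc j then 1 else 0) + b i * c j))
        $$ (i, j) = (T * R) $$ (i, j)"
      using ij by (simp add: T_def algebra_simps)
  qed (auto simp: T_def R_def)
  moreover have "det T = 1"
  proof -
    have "det T = prod_list (diag_mat T)"
      by (rule det_lower_triangular[of N]) (auto simp: T_def)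
    also have "diag_mat T = map (\<lambda>_. 1) [0..<N]"
      unfolding diag_mat_def by (intro map_cong) (auto simp: T_def)
    finally show ?thesis by (simp add: map_replicate_const)
  qed
  moreover have "det R = 1 - (\<Sum>i<N. c i * y i)"
    unfolding R_def by (rule det_one_minus_rank_one)
  moreover have "det (T * R) = det T * det R"
    by (rule det_mult[of _ N]) (auto simp: T_def R_def)
  ultimately show ?thesis by simp
qed

lemma word_sum_determinant:
  fixes ws :: "(complex \<times> 'v list) list"
  assumes "\<forall>(\<kappa>, u)\<in>set ws. u \<noteq> []" "(\<Sum>(\<kappa>, u)\<leftarrow>ws. norm \<kappa>) \<le> 1"
  defines "L \<equiv> concat (map snd ws)"
  obtains K where "contraction (length L) K"
    "\<And>w. det (mat (length L) (length L) (\<lambda>(i, j). (if i = j then 1 else 0) - w (L ! i) * K i j)) =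
       1 - (\<Sum>(\<kappa>, u)\<leftarrow>ws. \<kappa> * (\<Prod>x\<leftarrow>u. w x))"
proof -
  let ?N = "length L"
  obtain a b c where a0: "\<not> a 0" and ab: "\<And>i. a i \<Longrightarrow> b i = 0"
    and ac: "\<And>j. Suc j < ?N \<Longrightarrow> a (Suc j) \<Longrightarrow> c j = 0"
    and b: "(\<Sum>i<?N. (norm (b i))\<^sup>2) = (\<Sum>(\<kappa>, u)\<leftarrow>ws. norm \<kappa>)"
    and c: "(\<Sum>i<?N. (norm (c i))\<^sup>2) = (\<Sum>(\<kappa>, u)\<leftarrow>ws. norm \<kappa>)"
    and y: "\<And>(w :: 'v \<Rightarrow> complex) y. (\<forall>i<?N. y i = w (L ! i) * (b i + (if a i then y (i - 1) else 0))) \<Longrightarrow>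
       (\<Sum>i<?N. c i * y i) = (\<Sum>(\<kappa>, u)\<leftarrow>ws. \<kappa> * (\<Prod>x\<leftarrow>u. w x))"
    using word_network_exists[OF assms(1)] unfolding L_def by auto
  let ?K = "\<lambda>i j. (if a i \<and> i = Suc j then 1 else 0) + b i * c j"
  have "contraction ?N ?K"
    using assms(2) b c by (intro network_contraction a0 ab ac) auto
  moreover have "det (mat ?N ?N (\<lambda>(i, j). (if i = j then 1 else 0) - w (L ! i) * ?K i j)) =
       1 - (\<Sum>(\<kappa>, u)\<leftarrow>ws. \<kappa> * (\<Prod>x\<leftarrow>u. w x))" for w
  proof -
    define y' where "y' = rec_nat (w (L ! 0) * b 0)
      (\<lambda>i z. w (L ! Suc i) * (b (Suc i) + (if a (Suc i) then z else 0)))"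
    have y': "y' i = w (L ! i) * (b i + (if a i then y' (i - 1) else 0))" for i
      using a0 by (cases i) (simp_all add: y'_def)
    have "det (mat ?N ?N (\<lambda>(i, j). (if i = j then 1 else 0) - w (L ! i) * ?K i j)) = 1 - (\<Sum>i<?N. c i * y' i)"
      by (rule det_network[where a = a and b = b and c = c and w = "\<lambda>i. w (L ! i)" and y = y'])
         (rule a0, rule y')
    also have "(\<Sum>i<?N. c i * y' i) = (\<Sum>(\<kappa>, u)\<leftarrow>ws. \<kappa> * (\<Prod>x\<leftarrow>u. w x))"
      by (rule y, intro allI impI, rule y')
    finally show ?thesis .
  qed
  ultimately show ?thesis by (rule that)
qed

section \<open>Polynomials on the polydisc\<close>

lemma monomial_word:
  assumes "Poly_Mapping.keys m \<subseteq> V" "m \<noteq> 0"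
  obtains u where "u \<noteq> []" "set u \<subseteq> V" "\<And>w. (\<Prod>x\<leftarrow>u. w x) = monom_eval w m"
proof -
  obtain js where js: "set js = Poly_Mapping.keys m" "distinct js"
    using finite_distinct_list[of "Poly_Mapping.keys m"] by auto
  define u where "u = concat (map (\<lambda>j. replicate (Poly_Mapping.lookup m j) j) js)"
  have set_u: "set u = Poly_Mapping.keys m" using js by (auto simp: u_def in_keys_iff)
  moreover have "Poly_Mapping.keys m \<noteq> {}" using assms(2) by simp
  then have "u \<noteq> []" unfolding set_u[symmetric] by simp
  moreover have "(\<Prod>x\<leftarrow>u. w x) = monom_eval w m" for w :: "nat \<Rightarrow> complex"
  proof -
    have "(\<Prod>x\<leftarrow>concat (map (\<lambda>j. replicate (Poly_Mapping.lookup m j) j) js). w x)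
        = (\<Prod>j\<leftarrow>js. w j ^ Poly_Mapping.lookup m j)"
      by (induction js) (simp_all add: prod_list_replicate)
    also have "\<dots> = monom_eval w m"
      unfolding monom_eval_def js(1)[symmetric] using js(2) by (simp add: prod.distinct_set_conv_list)
    finally show ?thesis by (simp add: u_def)
  qed
  ultimately show ?thesis using assms(1) by (intro that[of u]) auto
qed

lemma polynomial_as_word_sum:
  assumes "poly_vars h \<subseteq> V" "0 \<notin> Poly_Mapping.keys h"
  obtains ws where "\<forall>(\<kappa>, u)\<in>set ws. u \<noteq> []" "set (concat (map snd ws)) \<subseteq> V"
    "(\<Sum>(\<kappa>, u)\<leftarrow>ws. norm \<kappa>) = (\<Sum>m\<in>Poly_Mapping.keys h. norm (Poly_Mapping.lookup h m))"
    "\<And>w. (\<Sum>(\<kappa>, u)\<leftarrow>ws. \<kappa> * (\<Prod>x\<leftarrow>u. w x)) = poly_eval h w"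
proof -
  have "\<exists>u. u \<noteq> [] \<and> set u \<subseteq> V \<and> (\<forall>w. (\<Prod>x\<leftarrow>u. w x) = monom_eval w m)"
    if "m \<in> Poly_Mapping.keys h" for m
  proof -
    have "m \<noteq> 0" using that assms(2) by metis
    from monomial_word[OF keys_of_poly_vars[OF assms(1) that] this] show ?thesis by metis
  qed
  then obtain word where word: "\<And>m. m \<in> Poly_Mapping.keys h \<Longrightarrow>
      word m \<noteq> [] \<and> set (word m) \<subseteq> V \<and> (\<forall>w. (\<Prod>x\<leftarrow>word m. w x) = monom_eval w m)"
    by metis
  obtain ms where ms: "set ms = Poly_Mapping.keys h" "distinct ms"
    using finite_distinct_list[of "Poly_Mapping.keys h"] by auto
  define ws where "ws = map (\<lambda>m. (Poly_Mapping.lookup h m, word m)) ms"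
  show ?thesis
  proof (rule that[of ws])
    show "\<forall>(\<kappa>, u)\<in>set ws. u \<noteq> []" "set (concat (map snd ws)) \<subseteq> V"
      using word ms(1) by (fastforce simp: ws_def)+
    show "(\<Sum>(\<kappa>, u)\<leftarrow>ws. norm \<kappa>) = (\<Sum>m\<in>Poly_Mapping.keys h. norm (Poly_Mapping.lookup h m))"
      using ms by (simp add: ws_def comp_def sum_list_distinct_conv_sum_set)
    fix w :: "nat \<Rightarrow> complex"
    have "(\<Sum>(\<kappa>, u)\<leftarrow>ws. \<kappa> * (\<Prod>x\<leftarrow>u. w x))
        = (\<Sum>m\<in>Poly_Mapping.keys h. Poly_Mapping.lookup h m * (\<Prod>x\<leftarrow>word m. w x))"
      using ms by (simp add: ws_def comp_def sum_list_distinct_conv_sum_set)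
    also have "\<dots> = poly_eval h w" unfolding poly_eval_monoms by (intro sum.cong) (simp_all add: word)
    finally show "(\<Sum>(\<kappa>, u)\<leftarrow>ws. \<kappa> * (\<Prod>x\<leftarrow>u. w x)) = poly_eval h w" .
  qed
qed

text \<open>Words with coefficient $0$ change nothing in the determinant, but they lengthen the list \<open>L\<close> of
  variables.  The list \<open>pad\<close> gives the caller a lower bound on the multiplicity of every variable, which may
  depend on the degree of \<open>G\<close>.\<close>

lemma polydisc_determinant:
  assumes "finite V" "poly_fun V D P" "1 < R" "0 < c"
    and lower: "\<forall>w. (\<forall>j\<in>V. norm (w j) < R) \<longrightarrow> c \<le> norm (P w)"
  shows "\<exists>e G. poly_fun V e G \<and> (\<forall>pad. set pad \<subseteq> V \<longrightarrow> (\<exists>L K. set L \<subseteq> V \<and>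
      (\<forall>j. count_list pad j \<le> count_list L j) \<and> contraction (length L) K \<and>
      (\<forall>w. det (mat (length L) (length L) (\<lambda>(i, j). (if i = j then 1 else 0) - w (L ! i) * K i j)) =
         P w * G w)))"
proof (rule multiple_close_to_1[OF assms(1-4)])
  show "c \<le> norm (P w)" if "\<forall>j\<in>V. norm (w j) < R" for w using lower that by blast
next
  fix e G h
  assume G: "poly_fun V e G" and h: "poly_vars h \<subseteq> V" "0 \<notin> Poly_Mapping.keys h"
    "(\<Sum>m\<in>Poly_Mapping.keys h. norm (Poly_Mapping.lookup h m)) \<le> 1"
    and PG: "\<And>w. P w * G w = 1 - poly_eval h w"
  obtain ws where ws: "\<forall>(\<kappa>, u)\<in>set ws. u \<noteq> []" "set (concat (map snd ws)) \<subseteq> V"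
    "(\<Sum>(\<kappa>, u)\<leftarrow>ws. norm \<kappa>) = (\<Sum>m\<in>Poly_Mapping.keys h. norm (Poly_Mapping.lookup h m))"
    "\<And>w. (\<Sum>(\<kappa>, u)\<leftarrow>ws. \<kappa> * (\<Prod>x\<leftarrow>u. w x)) = poly_eval h w"
    using polynomial_as_word_sum[OF h(1,2)] by metis
  have "\<exists>L K. set L \<subseteq> V \<and>
      (\<forall>j. count_list pad j \<le> count_list L j) \<and> contraction (length L) K \<and>
      (\<forall>w. det (mat (length L) (length L) (\<lambda>(i, j). (if i = j then 1 else 0) - w (L ! i) * K i j)) =
         P w * G w)" if pad: "set pad \<subseteq> V" for pad
  proof -
    define ws' where "ws' = ws @ map (\<lambda>j. (0, [j])) pad"
    define L where "L = concat (map snd ws')"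
    have L: "L = concat (map snd ws) @ pad" by (simp add: L_def ws'_def comp_def)
    have "\<forall>(\<kappa>, u)\<in>set ws'. u \<noteq> []" using ws(1) by (auto simp: ws'_def)
    moreover have "(\<Sum>(\<kappa>, u)\<leftarrow>ws'. norm \<kappa>) \<le> 1" using ws(3) h(3) by (simp add: ws'_def comp_def)
    ultimately obtain K where K: "contraction (length L) K"
      "\<And>w. det (mat (length L) (length L) (\<lambda>(i, j). (if i = j then 1 else 0) - w (L ! i) * K i j)) =
         1 - (\<Sum>(\<kappa>, u)\<leftarrow>ws'. \<kappa> * (\<Prod>x\<leftarrow>u. w x))"
      unfolding L_def using word_sum_determinant[of ws'] by blast
    moreover have "(\<Sum>(\<kappa>, u)\<leftarrow>ws'. \<kappa> * (\<Prod>x\<leftarrow>u. w x)) = poly_eval h w" for w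
      using ws(4)[of w] by (simp add: ws'_def comp_def)
    moreover have "set L \<subseteq> V" using ws(2) pad by (auto simp: L)
    ultimately show ?thesis using PG by (intro exI[of _ L] exI[of _ K]) (auto simp: L)
  qed
  with G show ?thesis by blast
qed

text \<open>Substituting a fractional affine map in every variable gives a polynomial once the denominators are
  cleared with exponents at least the degrees.  This covers the Cayley transform, its inverse, and dilations.\<close>

lemma homogenization:
  fixes a0 a1 b0 b1 :: complex
  assumes "finite V" "poly_vars q \<subseteq> V"
    and deg: "\<forall>m\<in>Poly_Mapping.keys q. \<forall>j\<in>V. Poly_Mapping.lookup m j \<le> E j"
  shows "\<exists>k H. poly_fun V k H \<and> (\<forall>z. (\<forall>j\<in>V. b1 * z j + b0 \<noteq> 0) \<longrightarrow>
    H z = (\<Prod>j\<in>V. (b1 * z j + b0) ^ E j) * poly_eval q (\<lambda>j. (a1 * z j + a0) / (b1 * z j + b0)))"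
proof -
  define H where "H z = (\<Sum>m\<in>Poly_Mapping.keys q. Poly_Mapping.lookup q m *
    (\<Prod>j\<in>V. (a1 * z j + a0) ^ Poly_Mapping.lookup m j * (b1 * z j + b0) ^ (E j - Poly_Mapping.lookup m j)))" for z
  have aff: "poly_fun V 1 (\<lambda>z. s * z j + t)" if "j \<in> V" for j s t
  proof -
    have "poly_fun V (0 + 1) (\<lambda>z. s * z j)"
      using that by (intro poly_fun_mult poly_fun_const poly_fun_var) auto
    then show ?thesis by (intro poly_fun_add poly_fun_const) simp
  qed
  have "poly_fun V (0 + (\<Sum>j\<in>V. E j)) H"
    unfolding H_def
  proof (intro poly_fun_sum poly_fun_mult poly_fun_const poly_fun_prod)
    fix m j assume mj: "m \<in> Poly_Mapping.keys q" "j \<in> V"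
    have "poly_fun V (Poly_Mapping.lookup m j * 1 + (E j - Poly_Mapping.lookup m j) * 1)
      (\<lambda>z. (a1 * z j + a0) ^ Poly_Mapping.lookup m j * (b1 * z j + b0) ^ (E j - Poly_Mapping.lookup m j))"
      using mj by (intro poly_fun_mult poly_fun_power aff)
    then show "poly_fun V (E j)
      (\<lambda>z. (a1 * z j + a0) ^ Poly_Mapping.lookup m j * (b1 * z j + b0) ^ (E j - Poly_Mapping.lookup m j))"
      using deg mj by simp
  qed
  moreover have "H z = (\<Prod>j\<in>V. (b1 * z j + b0) ^ E j) * poly_eval q (\<lambda>j. (a1 * z j + a0) / (b1 * z j + b0))"
    if nz: "\<forall>j\<in>V. b1 * z j + b0 \<noteq> 0" for z
    unfolding H_def poly_eval_monoms sum_distrib_left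
  proof (intro sum.cong refl)
    fix m assume m: "m \<in> Poly_Mapping.keys q"
    have "(\<Prod>j\<in>V. (a1 * z j + a0) ^ Poly_Mapping.lookup m j * (b1 * z j + b0) ^ (E j - Poly_Mapping.lookup m j))
      = (\<Prod>j\<in>V. (b1 * z j + b0) ^ E j * ((a1 * z j + a0) / (b1 * z j + b0)) ^ Poly_Mapping.lookup m j)"
    proof (intro prod.cong refl)
      fix j assume j: "j \<in> V"
      have "(b1 * z j + b0) ^ E j = (b1 * z j + b0) ^ (E j - Poly_Mapping.lookup m j) * (b1 * z j + b0) ^ Poly_Mapping.lookup m j"
        using deg m j by (simp flip: power_add)
      then show "(a1 * z j + a0) ^ Poly_Mapping.lookup m j * (b1 * z j + b0) ^ (E j - Poly_Mapping.lookup m j)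
        = (b1 * z j + b0) ^ E j * ((a1 * z j + a0) / (b1 * z j + b0)) ^ Poly_Mapping.lookup m j"
        using nz j by (simp add: power_divide)
    qed
    also have "\<dots> = (\<Prod>j\<in>V. (b1 * z j + b0) ^ E j) * monom_eval (\<lambda>j. (a1 * z j + a0) / (b1 * z j + b0)) m"
      using assms(1) keys_of_poly_vars[OF assms(2) m] by (simp add: prod.distrib monom_eval_superset[of V])
    finally show "Poly_Mapping.lookup q m *
      (\<Prod>j\<in>V. (a1 * z j + a0) ^ Poly_Mapping.lookup m j * (b1 * z j + b0) ^ (E j - Poly_Mapping.lookup m j))
      = (\<Prod>j\<in>V. (b1 * z j + b0) ^ E j) *
        (Poly_Mapping.lookup q m * monom_eval (\<lambda>j. (a1 * z j + a0) / (b1 * z j + b0)) m)"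
      by (simp only: mult_ac)
  qed
  ultimately show ?thesis by blast
qed

text \<open>The coefficients of $P(\rho^2 v) - P(v)$ tend to $0$ as $\rho \to 1$, so the bound on the unit polydisc
  survives in the form $|P(\rho^2 v)| \ge c/2$ there.  One factor $\rho$ is spent on enlarging the polydisc,
  the other one on the dilation of \<open>P\<close>.\<close>

lemma lower_bound_on_larger_polydisc:
  assumes "poly_fun V D P" "0 < c" and lower: "\<forall>w. (\<forall>j\<in>V. norm (w j) < 1) \<longrightarrow> c \<le> norm (P w)"
  shows "\<exists>\<rho>>1. \<forall>w. (\<forall>j\<in>V. norm (w j) < \<rho>) \<longrightarrow> c / 2 \<le> norm (P (\<lambda>j. complex_of_real \<rho> * w j))"
proof -
  obtain q where q: "poly_vars q \<subseteq> V" and Pq: "\<And>z. P z = poly_eval q z"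
    using assms(1) unfolding poly_fun_def by blast
  define g where "g \<rho> = (\<Sum>m\<in>Poly_Mapping.keys q. norm (Poly_Mapping.lookup q m) * ((\<rho> ^ 2) ^ total_deg m - 1))"
    for \<rho> :: real
  have "isCont g 1" unfolding g_def by (intro continuous_intros)
  then have "(g \<longlongrightarrow> g 1) (at_right 1)" by (simp add: isCont_def filterlim_at_split)
  moreover have "g 1 = 0" by (simp add: g_def)
  ultimately have "\<forall>\<^sub>F \<rho> in at_right 1. g \<rho> < c / 2"
    using assms(2) by (intro order_tendstoD(2)) auto
  moreover have "\<forall>\<^sub>F \<rho> in at_right (1::real). 1 < \<rho>" by (simp add: eventually_at_right_less)
  ultimately have "\<forall>\<^sub>F \<rho> in at_right 1. g \<rho> < c / 2 \<and> 1 < \<rho>" by (rule eventually_conj)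
  then obtain \<rho> where \<rho>: "g \<rho> < c / 2" "1 < \<rho>"
    using eventually_happens'[OF trivial_limit_at_right_real] by blast
  have "c / 2 \<le> norm (P (\<lambda>j. complex_of_real \<rho> * w j))" if w: "\<forall>j\<in>V. norm (w j) < \<rho>" for w
  proof -
    define v where "v j = w j / complex_of_real \<rho>" for j
    have v: "\<forall>j\<in>V. norm (v j) < 1" using w \<rho> by (auto simp: v_def norm_divide)
    have eq: "P (\<lambda>j. complex_of_real \<rho> * w j) = P (\<lambda>j. complex_of_real (\<rho> ^ 2) * v j)"
      using \<rho>(2) by (simp add: v_def power2_eq_square)
    have "norm (P (\<lambda>j. complex_of_real (\<rho> ^ 2) * v j) - P v) \<le> g \<rho>"
      unfolding Pq poly_eval_monoms g_def sum_subtractf[symmetric] monom_eval_scale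
    proof (rule sum_norm_le)
      fix m assume "m \<in> Poly_Mapping.keys q"
      then have mv: "norm (monom_eval v m) \<le> 1"
        using v by (intro norm_monom_le_1[of m V] keys_of_poly_vars[OF q]) (auto intro: less_imp_le)
      have ge: "1 \<le> (\<rho> ^ 2) ^ total_deg m" using \<rho>(2) by (intro one_le_power) simp
      have "Poly_Mapping.lookup q m * (complex_of_real (\<rho> ^ 2) ^ total_deg m * monom_eval v m)
          - Poly_Mapping.lookup q m * monom_eval v m
        = Poly_Mapping.lookup q m * complex_of_real ((\<rho> ^ 2) ^ total_deg m - 1) * monom_eval v m"
        by (simp add: algebra_simps)
      also have "norm \<dots> = norm (Poly_Mapping.lookup q m) * ((\<rho> ^ 2) ^ total_deg m - 1) * norm (monom_eval v m)"
        using ge by (simp add: norm_mult norm_of_real del: of_real_diff of_real_power)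
      also have "\<dots> \<le> norm (Poly_Mapping.lookup q m) * ((\<rho> ^ 2) ^ total_deg m - 1)"
        using mv ge by (intro mult_left_le) auto
      finally show "norm (Poly_Mapping.lookup q m * (complex_of_real (\<rho> ^ 2) ^ total_deg m * monom_eval v m)
          - Poly_Mapping.lookup q m * monom_eval v m)
        \<le> norm (Poly_Mapping.lookup q m) * ((\<rho> ^ 2) ^ total_deg m - 1)" .
    qed
    moreover have "c \<le> norm (P v)" using v lower by blast
    moreover have "norm (P v) - norm (P (\<lambda>j. complex_of_real (\<rho> ^ 2) * v j)) \<le>
        norm (P (\<lambda>j. complex_of_real (\<rho> ^ 2) * v j) - P v)"
      by (metis norm_minus_commute norm_triangle_ineq2)
    ultimately show ?thesis using \<rho>(1) unfolding eq by linarith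
  qed
  with \<rho>(2) show ?thesis by blast
qed

section \<open>Matrices over the half-plane\<close>

lemma mat_adjoint_index:
  assumes "A \<in> carrier_mat n m" "i < m" "j < n"
  shows "mat_adjoint A $$ (i, j) = conjugate (A $$ (j, i))"
  using assms unfolding mat_adjoint_def by (subst mat_of_rows_index) auto

lemma mat_adjoint_carrier:
  "A \<in> carrier_mat n m \<Longrightarrow> mat_adjoint A \<in> carrier_mat m n"
  unfolding mat_adjoint_def by auto

lemma hermitian_mat_iff:
  assumes "A \<in> carrier_mat N N"
  shows "hermitian_mat A \<longleftrightarrow> (\<forall>i<N. \<forall>j<N. cnj (A $$ (j, i)) = A $$ (i, j))"
proof -
  have "mat_adjoint A \<in> carrier_mat N N" using assms by (rule mat_adjoint_carrier)
  then have "mat_adjoint A = A \<longleftrightarrow> (\<forall>i<N. \<forall>j<N. mat_adjoint A $$ (i, j) = A $$ (i, j))"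
    using assms by (auto intro!: eq_matI)
  with assms show ?thesis by (auto simp: hermitian_mat_def mat_adjoint_index)
qed

lemma quadratic_form_sum:
  assumes "A \<in> carrier_mat N N" "v \<in> carrier_vec N"
  shows "(A *\<^sub>v v) \<bullet>c v = (\<Sum>i<N. (\<Sum>j<N. A $$ (i, j) * vec_index v j) * cnj (vec_index v i))"
  using assms by (simp add: scalar_prod_def atLeast0LessThan)

text \<open>The quadratic form of the adjoint is the complex conjugate of the quadratic form, so that of the
  imaginary part is the imaginary part of the form.\<close>

lemma Im_mat_form:
  assumes A: "A \<in> carrier_mat N N" and v: "v \<in> carrier_vec N"
  shows "Im_mat A \<in> carrier_mat N N" "hermitian_mat (Im_mat A)"
    "Re ((Im_mat A *\<^sub>v v) \<bullet>c v) = Im ((A *\<^sub>v v) \<bullet>c v)"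
proof -
  show I: "Im_mat A \<in> carrier_mat N N"
    unfolding Im_mat_def using A mat_adjoint_carrier[OF A] by (intro smult_carrier_mat minus_carrier_mat)
  have entry: "Im_mat A $$ (i, j) = (A $$ (i, j) - cnj (A $$ (j, i))) / (2 * \<i>)" if "i < N" "j < N" for i j
    using that A mat_adjoint_carrier[OF A] by (simp add: Im_mat_def mat_adjoint_index[OF A])
  show "hermitian_mat (Im_mat A)"
    unfolding hermitian_mat_iff[OF I]
  proof (intro allI impI)
    fix i j assume ij: "i < N" "j < N"
    have "cnj ((a - cnj b) / (2 * \<i>)) = - ((cnj a - b) / (2 * \<i>))" for a b
      by (simp only: complex_cnj_divide complex_cnj_mult complex_cnj_i complex_cnj_numeral complex_cnj_diff
          complex_cnj_cnj mult_minus_right minus_divide_right)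
    then show "cnj (Im_mat A $$ (j, i)) = Im_mat A $$ (i, j)"
      unfolding entry[OF ij] entry[OF ij(2,1)] minus_divide_left minus_diff_eq by simp
  qed
  define Q where "Q = (\<Sum>i<N. (\<Sum>j<N. A $$ (i, j) * vec_index v j) * cnj (vec_index v i))"
  have "cnj Q = (\<Sum>i<N. \<Sum>j<N. cnj (A $$ (i, j)) * cnj (vec_index v j) * vec_index v i)"
    by (simp add: Q_def sum_distrib_right)
  also have "\<dots> = (\<Sum>j<N. \<Sum>i<N. cnj (A $$ (i, j)) * cnj (vec_index v j) * vec_index v i)"
    by (rule sum.swap)
  finally have Q': "cnj Q = (\<Sum>j<N. \<Sum>i<N. cnj (A $$ (i, j)) * cnj (vec_index v j) * vec_index v i)" .
  have "(Im_mat A *\<^sub>v v) \<bullet>c v = (\<Sum>i<N. \<Sum>j<N. Im_mat A $$ (i, j) * vec_index v j * cnj (vec_index v i))"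
    unfolding quadratic_form_sum[OF I v] sum_distrib_right ..
  also have "\<dots> = (\<Sum>i<N. \<Sum>j<N. (A $$ (i, j) * vec_index v j * cnj (vec_index v i)
      - cnj (A $$ (j, i)) * cnj (vec_index v i) * vec_index v j) / (2 * \<i>))"
    by (intro sum.cong refl) (simp add: entry field_simps)
  also have "\<dots> = (Q - cnj Q) / (2 * \<i>)"
    unfolding Q' unfolding Q_def by (simp only: sum_divide_distrib sum_subtractf diff_divide_distrib sum_distrib_right)
  also have "Q - cnj Q = 2 * \<i> * complex_of_real (Im Q)" by (simp add: complex_eq_iff)
  finally show "Re ((Im_mat A *\<^sub>v v) \<bullet>c v) = Im ((A *\<^sub>v v) \<bullet>c v)"
    unfolding quadratic_form_sum[OF A v] Q_def[symmetric] by simp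
qed

lemma nonzero_vec_entry:
  fixes v :: "'a::zero Matrix.vec"
  assumes "v \<in> carrier_vec N" "v \<noteq> 0\<^sub>v N"
  obtains i where "i < N" "vec_index v i \<noteq> 0"
proof (rule ccontr)
  assume "\<not> thesis"
  then have "v = 0\<^sub>v N" using assms(1) that by (intro eq_vecI) auto
  with assms(2) show False by simp
qed

text \<open>The matrix is $A = i(1+S)(1-S)^{-1}$.  Writing $v = (1-S)u$ gives
  $\mathrm{Im}\,\langle Av, v\rangle = \mathrm{Re}\,\langle (1+S)u, (1-S)u\rangle = \|u\|^2 - \|Su\|^2$, which
  is positive.  The determinant identity is the product $(A + X)(1-S) = i(1+S) + X(1-S)$, with \<open>X\<close> the diagonal
  matrix with entries \<open>x i\<close>.\<close>

lemma cayley_transform_of_strict_contraction: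
  fixes K :: "nat \<Rightarrow> nat \<Rightarrow> complex"
  assumes "contraction N K" "1 < \<rho>"
  defines "S \<equiv> \<lambda>i j. K i j / complex_of_real \<rho>"
  shows "\<exists>A \<delta>. A \<in> carrier_mat N N \<and> pos_def_mat (Im_mat A) \<and> \<delta> \<noteq> 0 \<and>
    (\<forall>x. det (A + mat N N (\<lambda>(i, j). if i = j then x i else 0)) * \<delta> =
       det (mat N N (\<lambda>(i, j). (if i = j then x i + \<i> else 0) - (x i - \<i>) * S i j)))"
proof -
  define Sm where "Sm = mat N N (\<lambda>(i, j). S i j)"
  define M where "M = 1\<^sub>m N - Sm"
  have [simp]: "Sm \<in> carrier_mat N N" "M \<in> carrier_mat N N" by (auto simp: Sm_def M_def)
  have Sm_vec: "vec_index (Sm *\<^sub>v u) i = (\<Sum>j<N. S i j * vec_index u j)" if "u \<in> carrier_vec N" "i < N" for u i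
    using that by (simp add: Sm_def scalar_prod_def atLeast0LessThan)
  have M_vec: "vec_index (M *\<^sub>v u) i = vec_index u i - (\<Sum>j<N. S i j * vec_index u j)"
    if "u \<in> carrier_vec N" "i < N" for u i
  proof -
    have "M *\<^sub>v u = u - Sm *\<^sub>v u" using that by (simp add: M_def minus_mult_distrib_mat_vec[of _ N N])
    with that show ?thesis by (simp add: Sm_vec Sm_def scalar_prod_def atLeast0LessThan)
  qed
  have strict: "(\<Sum>i<N. (norm (\<Sum>j<N. S i j * vec_index u j))\<^sup>2) < (\<Sum>i<N. (norm (vec_index u i))\<^sup>2)"
    if u: "u \<in> carrier_vec N" "u \<noteq> 0\<^sub>v N" for u
  proof -
    obtain i where i: "i < N" "vec_index u i \<noteq> 0" using nonzero_vec_entry[OF u] by blast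
    have "0 < (norm (vec_index u i))\<^sup>2" using i by simp
    also have "\<dots> \<le> (\<Sum>i<N. (norm (vec_index u i))\<^sup>2)"
      using i by (intro member_le_sum) auto
    finally have pos: "0 < (\<Sum>i<N. (norm (vec_index u i))\<^sup>2)" .
    have "(\<Sum>i<N. (norm (\<Sum>j<N. S i j * vec_index u j))\<^sup>2)
       = (\<Sum>i<N. (norm (\<Sum>j<N. K i j * vec_index u j))\<^sup>2) / \<rho>\<^sup>2"
      by (simp add: S_def norm_divide power_divide flip: sum_divide_distrib)
    also have "\<dots> \<le> (\<Sum>i<N. (norm (vec_index u i))\<^sup>2) / \<rho>\<^sup>2"
      using assms(1) unfolding contraction_def by (intro divide_right_mono) auto
    also have "\<dots> < (\<Sum>i<N. (norm (vec_index u i))\<^sup>2) / 1"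
      using pos assms(2) by (intro divide_strict_left_mono) auto
    finally show ?thesis by simp
  qed
  have "det M \<noteq> 0"
  proof
    assume "det M = 0"
    then obtain u where u: "u \<in> carrier_vec N" "u \<noteq> 0\<^sub>v N" "M *\<^sub>v u = 0\<^sub>v N"
      using det_0_iff_vec_prod_zero[of M N] by auto
    have "(\<Sum>j<N. S i j * vec_index u j) = vec_index u i" if "i < N" for i
      using M_vec[OF u(1) that] u(3) that by simp
    with strict[OF u(1,2)] show False by simp
  qed
  then have "M \<in> Units (ring_mat TYPE(complex) N undefined)"
    by (intro det_non_zero_imp_unit) simp_all
  then obtain B where B: "B \<in> carrier_mat N N" "B * M = 1\<^sub>m N" "M * B = 1\<^sub>m N"
    unfolding Units_def ring_mat_simps by auto
  define A where "A = \<i> \<cdot>\<^sub>m ((1\<^sub>m N + Sm) * B)"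
  have A[simp]: "A \<in> carrier_mat N N" unfolding A_def using B(1)
    by (intro smult_carrier_mat mult_carrier_mat[of _ N N] add_carrier_mat) simp_all
  have AM: "A * M = \<i> \<cdot>\<^sub>m (1\<^sub>m N + Sm)"
  proof -
    have "A * M = \<i> \<cdot>\<^sub>m ((1\<^sub>m N + Sm) * B * M)"
      unfolding A_def using B(1)
      by (intro mult_smult_assoc_mat[of _ N N _ N] mult_carrier_mat[of _ N N] add_carrier_mat) simp_all
    also have "(1\<^sub>m N + Sm) * B * M = (1\<^sub>m N + Sm) * (B * M)"
      using B(1) by (intro assoc_mult_mat[of _ N N _ N _ N] add_carrier_mat) simp_all
    also have "\<dots> = 1\<^sub>m N + Sm"
      unfolding B(2) by (intro right_mult_one_mat[of _ N] add_carrier_mat) simp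
    finally show ?thesis .
  qed
  have "pos_def_mat (Im_mat A)"
    unfolding pos_def_mat_def
  proof (intro conjI ballI impI)
    show "hermitian_mat (Im_mat A)" using Im_mat_form(2)[OF A, of "0\<^sub>v N"] by simp
    have dim: "dim_row (Im_mat A) = N" using Im_mat_form(1)[OF A, of "0\<^sub>v N"] by simp
    fix v :: "complex Matrix.vec" assume "v \<in> carrier_vec (dim_row (Im_mat A))" "v \<noteq> 0\<^sub>v (dim_row (Im_mat A))"
    then have v: "v \<in> carrier_vec N" "v \<noteq> 0\<^sub>v N" by (simp_all add: dim)
    define u where "u = B *\<^sub>v v"
    have u: "u \<in> carrier_vec N" using B v by (simp add: u_def)
    have vu: "v = M *\<^sub>v u"
    proof -
      have "M *\<^sub>v u = (M * B) *\<^sub>v v"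
        unfolding u_def using B v by (intro assoc_mult_mat_vec[symmetric, of _ N N _ N]) auto
      with B v show ?thesis by simp
    qed
    have "u \<noteq> 0\<^sub>v N"
    proof
      assume "u = 0\<^sub>v N"
      then have "v = 0\<^sub>v N" unfolding vu by (intro eq_vecI) (auto simp: scalar_prod_def M_def Sm_def)
      with v(2) show False by simp
    qed
    note less = strict[OF u this]
    define k where "k i = (\<Sum>j<N. S i j * vec_index u j)" for i
    have v_i: "vec_index v i = vec_index u i - k i" if "i < N" for i
      unfolding vu k_def using u that by (rule M_vec)
    have AMu: "A *\<^sub>v v = (A * M) *\<^sub>v u"
      unfolding vu using u by (intro assoc_mult_mat_vec[symmetric, of _ N N _ N]) auto
    have Av: "vec_index (A *\<^sub>v v) i = \<i> * (vec_index u i + k i)" if "i < N" for i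
    proof -
      have "vec_index (A *\<^sub>v v) i = (\<Sum>j<N. \<i> * ((if j = i then vec_index u j else 0) + S i j * vec_index u j))"
        using that u unfolding AMu AM
        by (auto simp: scalar_prod_def Sm_def atLeast0LessThan algebra_simps intro!: sum.cong)
      also have "\<dots> = \<i> * (vec_index u i + k i)"
        using that by (simp add: k_def sum.distrib flip: sum_distrib_left)
      finally show ?thesis .
    qed
    have "(A *\<^sub>v v) \<bullet>c v = (\<Sum>i<N. vec_index (A *\<^sub>v v) i * cnj (vec_index v i))"
      using v by (simp add: scalar_prod_def atLeast0LessThan)
    also have "\<dots> = (\<Sum>i<N. \<i> * ((vec_index u i + k i) * cnj (vec_index u i - k i)))"
      by (intro sum.cong refl) (simp add: Av v_i mult.assoc)
    finally have "Im ((A *\<^sub>v v) \<bullet>c v) = (\<Sum>i<N. Re ((vec_index u i + k i) * cnj (vec_index u i - k i)))"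
      by (simp only: Im_sum) (simp add: Im_i_times)
    also have "\<dots> = (\<Sum>i<N. (norm (vec_index u i))\<^sup>2) - (\<Sum>i<N. (norm (k i))\<^sup>2)"
      unfolding sum_subtractf[symmetric] cmod_power2 by (intro sum.cong refl) (simp add: algebra_simps power2_eq_square)
    finally show "0 < Re ((Im_mat A *\<^sub>v v) \<bullet>c v)"
      using less unfolding Im_mat_form(3)[OF A v(1)] k_def by simp
  qed
  moreover have "det (A + mat N N (\<lambda>(i, j). if i = j then x i else 0)) * det M =
       det (mat N N (\<lambda>(i, j). (if i = j then x i + \<i> else 0) - (x i - \<i>) * S i j))" for x
  proof -
    let ?X = "mat N N (\<lambda>(i, j). if i = j then x i else 0)"
    have "det (A + ?X) * det M = det ((A + ?X) * M)"
      by (intro det_mult[symmetric, of _ N]) auto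
    also have "(A + ?X) * M = A * M + ?X * M"
      by (intro add_mult_distrib_mat[of _ N N _ _ N]) auto
    also have "?X * M = mat N N (\<lambda>(i, j). x i * M $$ (i, j))"
    proof -
      have "?X = mat_diag N x" unfolding mat_diag_def by (intro eq_matI) auto
      then show ?thesis by (simp only: mat_diag_mult_left[OF \<open>M \<in> carrier_mat N N\<close>])
    qed
    also have "A * M + mat N N (\<lambda>(i, j). x i * M $$ (i, j)) =
        mat N N (\<lambda>(i, j). (if i = j then x i + \<i> else 0) - (x i - \<i>) * S i j)"
      unfolding AM by (intro eq_matI) (auto simp: M_def Sm_def algebra_simps)
    finally show ?thesis .
  qed
  ultimately show ?thesis using A \<open>det M \<noteq> 0\<close>
    by (intro exI[of _ A] exI[of _ "det M"] conjI allI)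
qed

lemma det_scale_rows:
  fixes f :: "nat \<Rightarrow> 'a::comm_ring_1"
  shows "det (mat N N (\<lambda>(i, j). f i * B i j)) = (\<Prod>i<N. f i) * det (mat N N (\<lambda>(i, j). B i j))"
proof -
  have "det (mat N N (\<lambda>(i, j). f i * B i j)) = det (mat_diag N f * mat N N (\<lambda>(i, j). B i j))"
    by (subst mat_diag_mult_left[of _ _ N]) (auto intro!: arg_cong[of _ _ det])
  also have "\<dots> = det (mat_diag N f) * det (mat N N (\<lambda>(i, j). B i j))"
    by (rule det_mult) auto
  also have "det (mat_diag N f) = prod_list (diag_mat (mat_diag N f))"
    by (rule det_lower_triangular[of N]) (auto simp: mat_diag_def)
  also have "diag_mat (mat_diag N f) = map f [0..<N]"
    unfolding diag_mat_def by (intro map_cong) (auto simp: mat_diag_def)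
  also have "prod_list (map f [0..<N]) = (\<Prod>i<N. f i)"
    by (simp flip: prod.distinct_set_conv_list add: atLeast0LessThan)
  finally show ?thesis .
qed

lemma prod_nth_eq_prod_count:
  fixes f :: "'v \<Rightarrow> 'a::comm_monoid_mult"
  assumes "finite V" "set L \<subseteq> V"
  shows "(\<Prod>i<length L. f (L ! i)) = (\<Prod>j\<in>V. f j ^ count_list L j)"
  using assms(2)
proof (induction L)
  case (Cons a L)
  have "(\<Prod>i<length (a # L). f ((a # L) ! i)) = f a * (\<Prod>j\<in>V. f j ^ count_list L j)"
    using Cons by (simp add: prod.lessThan_Suc_shift del: prod.lessThan_Suc)
  also have "f a = (\<Prod>j\<in>V. if j = a then f j else 1)" using Cons.prems assms(1) by simp
  also have "\<dots> * (\<Prod>j\<in>V. f j ^ count_list L j) = (\<Prod>j\<in>V. f j ^ count_list (a # L) j)"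
    unfolding prod.distrib[symmetric] by (intro prod.cong) auto
  finally show ?case .
qed simp

text \<open>The matrices \<open>A j\<close> are the projections onto the coordinates that carry the variable \<open>j\<close>; they
  add up to the identity because every coordinate carries a variable.\<close>

lemma coordinate_matrices:
  fixes L :: "nat list" and d :: nat
  assumes "set L \<subseteq> {1..d}"
  defines "N \<equiv> length L"
  defines "A \<equiv> \<lambda>j. mat N N (\<lambda>(r, c). if r = c \<and> L ! r = j then 1 else (0::complex))"
  shows "pos_semidef_mat (A j)" "pos_def_mat (mat_sum N A {1..d})"
    "mat_sum N (\<lambda>j. z j \<cdot>\<^sub>m A j) {1..d} = mat N N (\<lambda>(r, c). if r = c then z (L ! r) else 0)"
proof -
  have A: "A j \<in> carrier_mat N N" by (simp add: A_def)
  have form: "Re ((mat N N (\<lambda>(r, c). if r = c then complex_of_real (g r) else 0) *\<^sub>v v) \<bullet>c v)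
      = (\<Sum>r<N. g r * (norm (vec_index v r))\<^sup>2)" if "v \<in> carrier_vec N" for g v
  proof -
    have "(mat N N (\<lambda>(r, c). if r = c then complex_of_real (g r) else 0) *\<^sub>v v) \<bullet>c v
      = (\<Sum>r<N. complex_of_real (g r) * vec_index v r * cnj (vec_index v r))"
      using that
      by (subst quadratic_form_sum[of _ N]) (auto intro!: sum.cong simp: if_distrib[of "\<lambda>x. x * _"] cong: if_cong)
    also have "\<dots> = complex_of_real (\<Sum>r<N. g r * (norm (vec_index v r))\<^sup>2)"
      by (simp add: mult.assoc complex_mult_cnj cmod_power2)
    finally show ?thesis by simp
  qed
  have A_real: "A j = mat N N (\<lambda>(r, c). if r = c then complex_of_real (if L ! r = j then 1 else 0) else 0)"
    unfolding A_def by (intro eq_matI) auto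
  show "pos_semidef_mat (A j)"
    unfolding pos_semidef_mat_def
  proof (intro conjI ballI)
    show "hermitian_mat (A j)" unfolding hermitian_mat_iff[OF A] by (auto simp: A_def)
    fix v :: "complex Matrix.vec" assume "v \<in> carrier_vec (dim_row (A j))"
    then have v: "v \<in> carrier_vec N" by (simp add: A_def)
    show "0 \<le> Re ((A j *\<^sub>v v) \<bullet>c v)" unfolding A_real form[OF v] by (intro sum_nonneg) auto
  qed
  have L: "L ! r \<in> {1..d}" if "r < N" for r
    using nth_mem[of r L] that assms(1) unfolding N_def by blast
  have one: "mat_sum N A {1..d} = mat N N (\<lambda>(r, c). if r = c then complex_of_real 1 else 0)"
    unfolding mat_sum_def
  proof (intro eq_matI)
    fix r c assume "r < dim_row (mat N N (\<lambda>(r, c). if r = c then complex_of_real 1 else 0))"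
      "c < dim_col (mat N N (\<lambda>(r, c). if r = c then complex_of_real 1 else 0))"
    then show "mat N N (\<lambda>(r, c). \<Sum>j\<in>{1..d}. A j $$ (r, c)) $$ (r, c) =
        mat N N (\<lambda>(r, c). if r = c then complex_of_real 1 else 0) $$ (r, c)"
      using L[of r] by (cases "r = c") (simp_all add: A_def)
  qed auto
  show "pos_def_mat (mat_sum N A {1..d})"
    unfolding pos_def_mat_def one
  proof (intro conjI ballI impI)
    show "hermitian_mat (mat N N (\<lambda>(r, c). if r = c then complex_of_real 1 else 0))"
      by (subst hermitian_mat_iff[of _ N]) auto
    fix v :: "complex Matrix.vec" assume "v \<in> carrier_vec (dim_row (mat N N (\<lambda>(r, c). if r = c then complex_of_real 1 else 0)))"
      "v \<noteq> 0\<^sub>v (dim_row (mat N N (\<lambda>(r, c). if r = c then complex_of_real 1 else 0)))"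
    then have v: "v \<in> carrier_vec N" "v \<noteq> 0\<^sub>v N" by simp_all
    obtain i where i: "i < N" "vec_index v i \<noteq> 0" using nonzero_vec_entry[OF v] by blast
    then show "0 < Re ((mat N N (\<lambda>(r, c). if r = c then complex_of_real 1 else 0) *\<^sub>v v) \<bullet>c v)"
      unfolding form[OF v(1)] by (intro sum_pos2[of _ i]) auto
  qed
  show "mat_sum N (\<lambda>j. z j \<cdot>\<^sub>m A j) {1..d} = mat N N (\<lambda>(r, c). if r = c then z (L ! r) else 0)"
    unfolding mat_sum_def
  proof (intro eq_matI)
    fix r c assume "r < dim_row (mat N N (\<lambda>(r, c). if r = c then z (L ! r) else 0))"
      "c < dim_col (mat N N (\<lambda>(r, c). if r = c then z (L ! r) else 0))"
    then show "mat N N (\<lambda>(r, c). \<Sum>j\<in>{1..d}. (z j \<cdot>\<^sub>m A j) $$ (r, c)) $$ (r, c) =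
        mat N N (\<lambda>(r, c). if r = c then z (L ! r) else 0) $$ (r, c)"
      using L[of r] by (cases "r = c") (simp_all add: A_def if_distrib cong: if_cong)
  qed auto
qed

section \<open>The determinantal representation\<close>

lemma poly_eval_cong:
  assumes "poly_vars p \<subseteq> V" "\<And>j. j \<in> V \<Longrightarrow> z j = z' j"
  shows "poly_eval p z = poly_eval p z'"
  unfolding poly_eval_def
proof (intro sum.cong refl)
  fix m assume "m \<in> Poly_Mapping.keys p"
  then have "Poly_Mapping.keys m \<subseteq> V" by (rule keys_of_poly_vars[OF assms(1)])
  then show "Poly_Mapping.lookup p m * (\<Prod>j\<in>Poly_Mapping.keys m. z j ^ Poly_Mapping.lookup m j) =
    Poly_Mapping.lookup p m * (\<Prod>j\<in>Poly_Mapping.keys m. z' j ^ Poly_Mapping.lookup m j)"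
    using assms(2) by (intro arg_cong2[of _ _ _ _ times] prod.cong) auto
qed

lemma lookup_le_degree_in:
  "m \<in> Poly_Mapping.keys p \<Longrightarrow> Poly_Mapping.lookup m j \<le> degree_in p j"
  unfolding degree_in_def by (intro Max_ge) auto

lemma cayley_disc_to_half_plane:
  fixes w :: complex
  assumes "norm w < 1"
  shows "- 1 * w + 1 \<noteq> 0" "Im ((\<i> * w + \<i>) / (- 1 * w + 1)) > 0"
    "norm ((\<i> * w + \<i>) / (- 1 * w + 1) + \<i>) = 2 / norm (- 1 * w + 1)"
proof -
  show nz: "- 1 * w + 1 \<noteq> 0" using assms by auto
  have "(\<i> * w + \<i>) / (- 1 * w + 1) + \<i> = 2 * \<i> / (- 1 * w + 1)" using nz by (simp add: field_simps)
  then show "norm ((\<i> * w + \<i>) / (- 1 * w + 1) + \<i>) = 2 / norm (- 1 * w + 1)"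
    by (simp add: norm_divide norm_mult)
  have "(norm w)\<^sup>2 < 1" using assms by (simp add: power_less_one_iff)
  then have "0 < 1 - (Re w)\<^sup>2 - (Im w)\<^sup>2" by (simp add: cmod_power2)
  moreover have "Im ((\<i> * w + \<i>) / (- 1 * w + 1)) = (1 - (Re w)\<^sup>2 - (Im w)\<^sup>2) / (norm (- 1 * w + 1))\<^sup>2"
    by (subst complex_div_cnj) (simp add: algebra_simps power2_eq_square)
  ultimately show "Im ((\<i> * w + \<i>) / (- 1 * w + 1)) > 0" using nz by simp
qed

lemma cayley_half_plane_to_disc:
  fixes z :: complex
  assumes "z + \<i> \<noteq> 0"
  defines "w \<equiv> (z - \<i>) / (z + \<i>)"
  shows "- 1 * w + 1 = 2 * \<i> / (z + \<i>)" "(\<i> * w + \<i>) / (- 1 * w + 1) = z"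
proof -
  show w: "- 1 * w + 1 = 2 * \<i> / (z + \<i>)" using assms(1) by (simp add: w_def field_simps)
  have num: "\<i> * w + \<i> = 2 * \<i> * z / (z + \<i>)" using assms(1) by (simp add: w_def field_simps)
  show "(\<i> * w + \<i>) / (- 1 * w + 1) = z" unfolding w num using assms(1) by simp
qed

lemma continuous_poly_eval_line: "isCont (\<lambda>t. poly_eval p (\<lambda>j. z j + t)) a"
  unfolding poly_eval_def by (intro continuous_intros)

lemma continuous_det:
  fixes F :: "complex \<Rightarrow> complex mat"
  assumes "\<And>t. F t \<in> carrier_mat N N" "\<And>i j. i < N \<Longrightarrow> j < N \<Longrightarrow> isCont (\<lambda>t. F t $$ (i, j)) a"
  shows "isCont (\<lambda>t. det (F t)) a"
proof -
  have "isCont (\<lambda>t. \<Sum>p | p permutes {0..<N}. signof p * (\<Prod>i = 0..<N. F t $$ (i, p i))) a"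
  proof (intro continuous_intros)
    fix p i assume "p \<in> {p. p permutes {0..<N}}" "i \<in> {0..<N}"
    then show "isCont (\<lambda>t. F t $$ (i, p i)) a"
      using permutes_in_image[of p "{0..<N}" i] by (intro assms(2)) auto
  qed
  then show ?thesis using det_def'[OF assms(1)] by simp
qed

text \<open>Shifting all variables by the same small \<open>t \<noteq> 0\<close> avoids $z_j + t + b = 0$ for the
  finitely many indices \<open>j\<close>, so an identity proved away from them extends by continuity.\<close>

lemma eq_of_eq_off_finitely_many_shifts:
  fixes f g :: "(nat \<Rightarrow> complex) \<Rightarrow> complex" and b :: complex
  assumes "finite V" "\<And>z. isCont (\<lambda>t. f (\<lambda>j. z j + t)) 0" "\<And>z. isCont (\<lambda>t. g (\<lambda>j. z j + t)) 0"
    and eq: "\<And>z. (\<forall>j\<in>V. z j + b \<noteq> 0) \<Longrightarrow> f z = g z"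
  shows "f z = g z"
proof -
  have "\<forall>\<^sub>F t in at 0. t \<noteq> - b - z j" for j by (rule eventually_neq_at_within)
  then have "\<forall>\<^sub>F t in at 0. \<forall>j\<in>V. t \<noteq> - b - z j" using assms(1) by (intro eventually_ball_finite) auto
  then have ev: "\<forall>\<^sub>F t in at 0. f (\<lambda>j. z j + t) = g (\<lambda>j. z j + t)"
  proof eventually_elim
    case (elim t)
    then have "z j + t + b \<noteq> 0" if "j \<in> V" for j
      using that by (metis add_diff_cancel_right' add.commute add.assoc eq_neg_iff_add_eq_0 diff_eq_eq)
    then show ?case by (intro eq) auto
  qed
  have lim: "((\<lambda>t. f (\<lambda>j. z j + t)) \<longlongrightarrow> f z) (at 0)" "((\<lambda>t. g (\<lambda>j. z j + t)) \<longlongrightarrow> g z) (at 0)"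
    using assms(2,3)[of z] unfolding isCont_def by simp_all
  show ?thesis
    by (rule tendsto_unique[OF at_neq_bot Lim_transform_eventually[OF lim(1) ev] lim(2)])
qed

lemma mat_sum_cong:
  assumes "\<And>j. j \<in> J \<Longrightarrow> B j = B' j"
  shows "mat_sum N B J = mat_sum N B' J"
proof -
  have "(\<Sum>j\<in>J. B j $$ rc) = (\<Sum>j\<in>J. B' j $$ rc)" for rc
    by (intro sum.cong refl) (simp only: assms)
  then show ?thesis by (simp only: mat_sum_def)
qed

theorem theorem3p1:
  fixes d :: nat and n :: "nat \<Rightarrow> nat" and p :: cpoly and \<epsilon> :: real
  assumes "d \<ge> 1"
    and "poly_vars p \<subseteq> {1..d}"
    and "\<forall>j\<in>{1..d}. degree_in p j = n j"
    and "\<epsilon> > 0"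
    and "\<forall>z :: nat \<Rightarrow> complex. (\<forall>j\<in>{1..d}. Im (z j) > 0) \<longrightarrow>
           norm (poly_eval p z) \<ge> \<epsilon> * (\<Prod>j=1..d. norm (z j + \<i>) ^ n j)"
  shows "\<exists>(q :: cpoly) (N :: nat) (A :: nat \<Rightarrow> complex mat).
           poly_vars q \<subseteq> {1..d} \<and>
           N \<ge> 1 \<and>
           (\<forall>j\<in>{0..d}. A j \<in> carrier_mat N N) \<and>
           pos_def_mat (Im_mat (A 0)) \<and>
           (\<forall>j\<in>{1..d}. pos_semidef_mat (A j)) \<and>
           pos_def_mat (mat_sum N A {1..d}) \<and>
           (\<forall>z :: nat \<Rightarrow> complex.
              poly_eval p z * poly_eval q z =
                det (A 0 + mat_sum N (\<lambda>j. z j \<cdot>\<^sub>m A j) {1..d}))"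
proof -
  define V where "V = {1..d}"
  have V: "finite V" by (simp add: V_def)
  have pV: "poly_vars p \<subseteq> V" using assms(2) by (simp add: V_def)
  have "\<forall>m\<in>Poly_Mapping.keys p. \<forall>j\<in>V. Poly_Mapping.lookup m j \<le> n j"
    using lookup_le_degree_in[of _ p] assms(3) unfolding V_def by metis
  \<comment> \<open>\<open>p\<close> at the inverse Cayley transform of \<open>w\<close>, with denominators cleared.\<close>
  from homogenization[OF V pV this, of "- 1" 1 \<i> \<i>]
  obtain k0 P0 where P0: "poly_fun V k0 P0"
    and P0_all: "\<forall>w. (\<forall>j\<in>V. - 1 * w j + 1 \<noteq> 0) \<longrightarrow> P0 w =
      (\<Prod>j\<in>V. (- 1 * w j + 1) ^ n j) * poly_eval p (\<lambda>j. (\<i> * w j + \<i>) / (- 1 * w j + 1))"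
    by (elim exE conjE) (rule that)
  note P0_eq = P0_all[THEN spec, THEN mp]
  define c where "c = \<epsilon> * (\<Prod>j\<in>V. 2 ^ n j)"
  have c: "0 < c" using assms(4) by (simp add: c_def prod_pos)
  have P0_lower: "c \<le> norm (P0 w)" if w: "\<forall>j\<in>V. norm (w j) < 1" for w
  proof -
    have nz: "\<forall>j\<in>V. - 1 * w j + 1 \<noteq> 0" using w cayley_disc_to_half_plane(1) by blast
    let ?z = "\<lambda>j. (\<i> * w j + \<i>) / (- 1 * w j + 1)"
    have "\<epsilon> * (\<Prod>j\<in>V. norm (?z j + \<i>) ^ n j) \<le> norm (poly_eval p ?z)"
      using assms(5)[rule_format, of ?z] w cayley_disc_to_half_plane(2) by (simp only: V_def)
    then have "(\<Prod>j\<in>V. norm (- 1 * w j + 1) ^ n j) * (\<epsilon> * (\<Prod>j\<in>V. norm (?z j + \<i>) ^ n j))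
        \<le> (\<Prod>j\<in>V. norm (- 1 * w j + 1) ^ n j) * norm (poly_eval p ?z)"
      by (intro mult_left_mono prod_nonneg) auto
    also have "\<dots> = norm (P0 w)"
      unfolding P0_eq[OF nz] norm_mult prod_norm[symmetric] norm_power ..
    also have "(\<Prod>j\<in>V. norm (- 1 * w j + 1) ^ n j) * (\<epsilon> * (\<Prod>j\<in>V. norm (?z j + \<i>) ^ n j))
        = \<epsilon> * (\<Prod>j\<in>V. norm (- 1 * w j + 1) ^ n j * norm (?z j + \<i>) ^ n j)"
      by (simp only: prod.distrib mult_ac)
    also have "(\<Prod>j\<in>V. norm (- 1 * w j + 1) ^ n j * norm (?z j + \<i>) ^ n j) = (\<Prod>j\<in>V. 2 ^ n j)"
    proof (intro prod.cong refl)
      fix j assume j: "j \<in> V"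
      then have "norm (?z j + \<i>) = 2 / norm (- 1 * w j + 1)" using w cayley_disc_to_half_plane(3) by blast
      moreover have "norm (- 1 * w j + 1) \<noteq> 0" using nz j by simp
      ultimately show "norm (- 1 * w j + 1) ^ n j * norm (?z j + \<i>) ^ n j = 2 ^ n j"
        by (simp only: power_mult_distrib[symmetric]) simp
    qed
    finally show ?thesis by (simp add: c_def)
  qed
  obtain \<rho> where \<rho>: "1 < \<rho>"
    and P_lower: "\<And>w. (\<forall>j\<in>V. norm (w j) < \<rho>) \<Longrightarrow> c / 2 \<le> norm (P0 (\<lambda>j. complex_of_real \<rho> * w j))"
    using lower_bound_on_larger_polydisc[OF P0 c] P0_lower by blast
  obtain q0 where q0: "poly_vars q0 \<subseteq> V" "\<And>m. m \<in> Poly_Mapping.keys q0 \<Longrightarrow> total_deg m \<le> k0"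
    "\<And>w. P0 w = poly_eval q0 w"
    using P0 unfolding poly_fun_def by blast
  have "\<forall>m\<in>Poly_Mapping.keys q0. \<forall>j\<in>V. Poly_Mapping.lookup m j \<le> k0"
    using lookup_le_total_deg q0(2) order_trans by blast
  \<comment> \<open>The dilation of \<open>P0\<close>; the denominators are \<open>1\<close>, so a common bound for all degrees can serve as exponent.\<close>
  from homogenization[OF V q0(1) this, of 0 1 "complex_of_real \<rho>" 0]
  obtain k P where P: "poly_fun V k P" and "\<And>w. P w = poly_eval q0 (\<lambda>j. complex_of_real \<rho> * w j)"
    by auto
  then have P_eq: "P w = P0 (\<lambda>j. complex_of_real \<rho> * w j)" for w by (simp add: q0(3))
  have "0 < c / 2" using c by simp
  moreover have "\<forall>w. (\<forall>j\<in>V. norm (w j) < \<rho>) \<longrightarrow> c / 2 \<le> norm (P w)"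
    using P_lower by (simp add: P_eq)
  ultimately have "\<exists>e G. poly_fun V e G \<and> (\<forall>pad. set pad \<subseteq> V \<longrightarrow> (\<exists>L K. set L \<subseteq> V \<and>
      (\<forall>j. count_list pad j \<le> count_list L j) \<and> contraction (length L) K \<and>
      (\<forall>w. det (mat (length L) (length L) (\<lambda>(i, j). (if i = j then 1 else 0) - w (L ! i) * K i j)) =
         P w * G w)))"
    by (rule polydisc_determinant[OF V P \<rho>])
  then
  obtain e G where G: "poly_fun V e G" and det_G: "\<forall>pad. set pad \<subseteq> V \<longrightarrow> (\<exists>L K. set L \<subseteq> V \<and>
      (\<forall>j. count_list pad j \<le> count_list L j) \<and> contraction (length L) K \<and>
      (\<forall>w. det (mat (length L) (length L) (\<lambda>(i, j). (if i = j then 1 else 0) - w (L ! i) * K i j)) =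
         P w * G w))"
    by (elim exE conjE) (rule that)
  \<comment> \<open>Multiplicity \<open>n j\<close> clears the denominators of \<open>P\<close> below, \<open>e\<close> those of \<open>G\<close>, and \<open>1\<close> makes the size positive.\<close>
  define pad where "pad = concat (map (\<lambda>j. replicate (n j + e + 1) j) [1..<Suc d])"
  have pad: "set pad \<subseteq> V" by (auto simp: pad_def V_def)
  have pad_count: "n j + e + 1 \<le> count_list pad j" if "j \<in> V" for j
  proof -
    have rep: "count_list (replicate k i) j = (if i = j then k else 0)" for k i by (induction k) auto
    have "j \<in> set js \<Longrightarrow> n j + e + 1 \<le> count_list (concat (map (\<lambda>j. replicate (n j + e + 1) j) js)) j" for js
      by (induction js) (auto simp: rep)
    from this[of "[1..<Suc d]"] that show ?thesis unfolding pad_def V_def set_upt by auto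
  qed
  obtain L K where L: "set L \<subseteq> V" "\<forall>j. count_list pad j \<le> count_list L j" and K: "contraction (length L) K"
    and det_K: "\<forall>w. det (mat (length L) (length L) (\<lambda>(i, j). (if i = j then 1 else 0) - w (L ! i) * K i j)) =
         P w * G w"
    using det_G[THEN spec, THEN mp, OF pad] by (elim exE conjE) (rule that)
  define N where "N = length L"
  have count: "n j + e + 1 \<le> count_list L j" if "j \<in> V" for j
    using pad_count[OF that] L(2)[THEN spec, of j] by linarith
  have "1 \<in> V" using assms(1) by (simp add: V_def)
  from count[OF this] have "L \<noteq> []" by auto
  then have N: "1 \<le> N" by (simp add: N_def Suc_le_eq)
  obtain g where g: "poly_vars g \<subseteq> V" "\<And>m. m \<in> Poly_Mapping.keys g \<Longrightarrow> total_deg m \<le> e"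
    "\<And>w. G w = poly_eval g w"
    using G unfolding poly_fun_def by blast
  define E where "E j = count_list L j - n j" for j
  have "\<forall>m\<in>Poly_Mapping.keys g. \<forall>j\<in>V. Poly_Mapping.lookup m j \<le> E j"
  proof (intro ballI)
    fix m j assume "m \<in> Poly_Mapping.keys g" "j \<in> V"
    then show "Poly_Mapping.lookup m j \<le> E j"
      using lookup_le_total_deg[of m j] g(2)[of m] count[of j] by (simp add: E_def)
  qed
  \<comment> \<open>The polynomial \<open>G\<close> at the dilated Cayley transform of \<open>z\<close>, with the row factors that \<open>p\<close> leaves over.\<close>
  from homogenization[OF V g(1) this, of 1 \<i> "1 / complex_of_real \<rho>" "- \<i> / complex_of_real \<rho>"]
  obtain kH H where H: "poly_fun V kH H"
    and H_all: "\<forall>z. (\<forall>j\<in>V. 1 * z j + \<i> \<noteq> 0) \<longrightarrow> H z = (\<Prod>j\<in>V. (1 * z j + \<i>) ^ E j) *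
      poly_eval g (\<lambda>j. (1 / complex_of_real \<rho> * z j + - \<i> / complex_of_real \<rho>) / (1 * z j + \<i>))"
    by (elim exE conjE) (rule that)
  note H_eq = H_all[THEN spec, THEN mp]
  obtain A0 \<delta> where A0: "A0 \<in> carrier_mat N N" "pos_def_mat (Im_mat A0)" and \<delta>: "\<delta> \<noteq> 0"
    and det_A0: "\<forall>x. det (A0 + mat N N (\<lambda>(i, j). if i = j then x i else 0)) * \<delta> =
       det (mat N N (\<lambda>(i, j). (if i = j then x i + \<i> else 0) - (x i - \<i>) * (K i j / complex_of_real \<rho>)))"
    using cayley_transform_of_strict_contraction[OF K \<rho>] unfolding N_def[symmetric]
    by (elim exE conjE) (rule that)
  \<comment> \<open>The powers of \<open>2 * \<i>\<close> come from \<open>1 - \<omega> j = 2 * \<i> / (z j + \<i>)\<close>, and \<open>\<delta>\<close> is the determinant split off with \<open>A0\<close>.\<close>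
  define C where "C = (\<Prod>j\<in>V. (2 * \<i>) ^ n j) / \<delta>"
  have "poly_fun V (0 + kH) (\<lambda>z. C * H z)" by (intro poly_fun_mult poly_fun_const H)
  then obtain q where q: "poly_vars q \<subseteq> V" "\<And>z. C * H z = poly_eval q z"
    unfolding poly_fun_def by blast
  define D where "D z = det (A0 + mat N N (\<lambda>(i, j). if i = j then z (L ! i) else 0))" for z
  have generic: "poly_eval p z * poly_eval q z = D z" if nz: "\<forall>j\<in>V. z j + \<i> \<noteq> 0" for z
  proof -
    \<comment> \<open>The Cayley transform of \<open>z\<close>; \<open>w\<close> undoes the dilation built into \<open>P\<close>.\<close>
    define \<omega> where "\<omega> j = (z j - \<i>) / (z j + \<i>)" for j
    define w where "w j = \<omega> j / complex_of_real \<rho>" for j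
    have LV: "L ! i \<in> V" if "i < N" for i
      using nth_mem[of i L] that L(1) unfolding N_def by blast
    have "D z * \<delta> = det (mat N N (\<lambda>(i, j). (z (L ! i) + \<i>) * ((if i = j then 1 else 0) - w (L ! i) * K i j)))"
      unfolding D_def det_A0[THEN spec]
    proof (intro arg_cong[of _ _ det] eq_matI)
      fix i j
      assume "i < dim_row (mat N N (\<lambda>(i, j). (z (L ! i) + \<i>) * ((if i = j then 1 else 0) - w (L ! i) * K i j)))"
        "j < dim_col (mat N N (\<lambda>(i, j). (z (L ! i) + \<i>) * ((if i = j then 1 else 0) - w (L ! i) * K i j)))"
      then have ij: "i < N" "j < N" by simp_all
      then have "(z (L ! i) + \<i>) * w (L ! i) = (z (L ! i) - \<i>) / complex_of_real \<rho>"
        using nz LV[of i] by (simp add: w_def \<omega>_def)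
      then have "(z (L ! i) + \<i>) * (w (L ! i) * K i j) = (z (L ! i) - \<i>) * (K i j / complex_of_real \<rho>)"
        by (simp add: mult.assoc[symmetric])
      with ij show "mat N N (\<lambda>(i, j). (if i = j then z (L ! i) + \<i> else 0) -
            (z (L ! i) - \<i>) * (K i j / complex_of_real \<rho>)) $$ (i, j) =
          mat N N (\<lambda>(i, j). (z (L ! i) + \<i>) * ((if i = j then 1 else 0) - w (L ! i) * K i j)) $$ (i, j)"
        by (simp add: right_diff_distrib)
    qed simp_all
    also have "\<dots> = (\<Prod>i<N. z (L ! i) + \<i>) * (P w * G w)"
      unfolding det_scale_rows det_K[THEN spec, symmetric] N_def ..
    also have "(\<Prod>i<N. z (L ! i) + \<i>) = (\<Prod>j\<in>V. (z j + \<i>) ^ count_list L j)"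
      unfolding N_def by (rule prod_nth_eq_prod_count[OF V L(1)])
    also have "\<dots> = (\<Prod>j\<in>V. (z j + \<i>) ^ n j) * (\<Prod>j\<in>V. (z j + \<i>) ^ E j)"
      unfolding prod.distrib[symmetric] using count
      by (intro prod.cong refl) (force simp: E_def simp flip: power_add)
    also have "P w = (\<Prod>j\<in>V. (2 * \<i> / (z j + \<i>)) ^ n j) * poly_eval p z"
    proof -
      have \<omega>: "- 1 * \<omega> j + 1 = 2 * \<i> / (z j + \<i>)" "(\<i> * \<omega> j + \<i>) / (- 1 * \<omega> j + 1) = z j" if "j \<in> V" for j
        using cayley_half_plane_to_disc[of "z j"] nz that unfolding \<omega>_def by blast+
      have "P w = P0 \<omega>" using \<rho> by (simp add: P_eq w_def)
      also have "\<dots> = (\<Prod>j\<in>V. (- 1 * \<omega> j + 1) ^ n j) * poly_eval p (\<lambda>j. (\<i> * \<omega> j + \<i>) / (- 1 * \<omega> j + 1))"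
      proof (rule P0_eq, intro ballI)
        fix j assume "j \<in> V"
        then show "- 1 * \<omega> j + 1 \<noteq> 0" unfolding \<omega>(1)[OF \<open>j \<in> V\<close>] using nz by simp
      qed
      also have "poly_eval p (\<lambda>j. (\<i> * \<omega> j + \<i>) / (- 1 * \<omega> j + 1)) = poly_eval p z"
        by (rule poly_eval_cong[OF pV]) (rule \<omega>(2))
      also have "(\<Prod>j\<in>V. (- 1 * \<omega> j + 1) ^ n j) = (\<Prod>j\<in>V. (2 * \<i> / (z j + \<i>)) ^ n j)"
        by (intro prod.cong refl) (simp only: \<omega>(1))
      finally show ?thesis .
    qed
    also have "(\<Prod>j\<in>V. (z j + \<i>) ^ n j) * (\<Prod>j\<in>V. (z j + \<i>) ^ E j) *
        ((\<Prod>j\<in>V. (2 * \<i> / (z j + \<i>)) ^ n j) * poly_eval p z * G w)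
      = ((\<Prod>j\<in>V. (z j + \<i>) ^ n j) * (\<Prod>j\<in>V. (2 * \<i> / (z j + \<i>)) ^ n j)) * poly_eval p z *
        ((\<Prod>j\<in>V. (z j + \<i>) ^ E j) * G w)"
      by (simp only: mult_ac)
    also have "(\<Prod>j\<in>V. (z j + \<i>) ^ n j) * (\<Prod>j\<in>V. (2 * \<i> / (z j + \<i>)) ^ n j) = C * \<delta>"
    proof -
      have "(z j + \<i>) ^ n j * (2 * \<i> / (z j + \<i>)) ^ n j = (2 * \<i>) ^ n j" if "j \<in> V" for j
        using nz that unfolding power_mult_distrib[symmetric] by simp
      then have "(\<Prod>j\<in>V. (z j + \<i>) ^ n j) * (\<Prod>j\<in>V. (2 * \<i> / (z j + \<i>)) ^ n j) = (\<Prod>j\<in>V. (2 * \<i>) ^ n j)"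
        unfolding prod.distrib[symmetric] by (rule prod.cong[OF refl])
      then show ?thesis using \<delta> by (simp add: C_def)
    qed
    also have "(\<Prod>j\<in>V. (z j + \<i>) ^ E j) * G w = H z"
    proof -
      have "(1 / complex_of_real \<rho> * z j + - \<i> / complex_of_real \<rho>) / (1 * z j + \<i>) = w j" for j
        by (simp add: w_def \<omega>_def diff_divide_distrib mult.commute divide_divide_eq_left')
      then show ?thesis using nz by (simp add: H_eq g(3))
    qed
    finally have "D z * \<delta> = poly_eval p z * (C * H z) * \<delta>" by (simp only: mult_ac)
    then show ?thesis using \<delta> by (simp add: q(2))
  qed
  have all: "poly_eval p z * poly_eval q z = D z" for z
  proof (rule eq_of_eq_off_finitely_many_shifts[OF V _ _ generic])
    fix z :: "nat \<Rightarrow> complex"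
    show "isCont (\<lambda>t. poly_eval p (\<lambda>j. z j + t) * poly_eval q (\<lambda>j. z j + t)) 0"
      by (intro continuous_intros continuous_poly_eval_line)
    show "isCont (\<lambda>t. D (\<lambda>j. z j + t)) 0"
      unfolding D_def
    proof (rule continuous_det[of _ N])
      fix i j assume "i < N" "j < N"
      then show "isCont (\<lambda>t. (A0 + mat N N (\<lambda>(i, j). if i = j then z (L ! i) + t else 0)) $$ (i, j)) 0"
        using A0(1) by (cases "i = j") (auto intro!: continuous_intros)
    qed (use A0(1) in simp)
  qed
  define A where "A j = (if j = 0 then A0 else mat N N (\<lambda>(r, c). if r = c \<and> L ! r = j then 1 else (0::complex)))" for j
  have LV: "set L \<subseteq> {1..d}" using L(1) by (simp add: V_def)
  define X where "X j = mat N N (\<lambda>(r, c). if r = c \<and> L ! r = j then 1 else (0::complex))" for j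
  have A_pos: "A j = X j" if "j \<in> {1..d}" for j
    using that by (simp add: A_def X_def)
  have "pos_semidef_mat (A j)" if "j \<in> {1..d}" for j
    unfolding A_pos[OF that] X_def N_def by (rule coordinate_matrices(1)[OF LV])
  moreover have "mat_sum N A {1..d} = mat_sum N X {1..d}"
    by (rule mat_sum_cong) (rule A_pos)
  then have "pos_def_mat (mat_sum N A {1..d})"
    using coordinate_matrices(2)[OF LV] by (simp only: X_def[abs_def] N_def)
  moreover have "mat_sum N (\<lambda>j. z j \<cdot>\<^sub>m A j) {1..d} = mat N N (\<lambda>(r, c). if r = c then z (L ! r) else 0)" for z
  proof -
    have "mat_sum N (\<lambda>j. z j \<cdot>\<^sub>m A j) {1..d} = mat_sum N (\<lambda>j. z j \<cdot>\<^sub>m X j) {1..d}"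
      by (rule mat_sum_cong) (simp only: A_pos)
    then show ?thesis using coordinate_matrices(3)[OF LV, of z] by (simp only: X_def N_def)
  qed
  moreover have "A j \<in> carrier_mat N N" for j using A0(1) by (simp add: A_def)
  moreover have "A 0 = A0" by (simp add: A_def)
  ultimately show ?thesis
    using q(1) N A0(2) all
    by (intro exI[of _ q] exI[of _ N] exI[of _ A] conjI allI ballI) (simp_all add: D_def V_def)
qed

end
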